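(* Let $p=(p(1),p(2),\dots)$ be a probability measure on the positive integers, not concentrated at $1$, such that $$\mu=\sum_{k=1}^\infty p(k)\log k<\infty .$$ Fix $\epsilon\in(0,1)$. Then for any sequence of non-negative integers $k_n$ with $k_n>(1+\epsilon)\frac{3}{2\mu}\log n$ for all $n$, $$\lim_{n\to\infty}\|Q_{n,p}^{k_n}-U_n\|_{\mathrm{TV}}=0,$$ whereas for any sequence of non-negative integers $k_n$ with $k_n<(1-\epsilon)\frac{3}{2\mu}\log n$ for all sufficiently large $n$, $$\lim_{n\to\infty}\|Q_{n,p}^{k_n}-U_n\|_{\mathrm{TV}}=1.$$
   Context: Shuffles. $S_n$ is the set of arrangements of a deck of $n$ cards labelled $1,\dots,n$, identified with the symmetric group (an arrangement $\sigma$ lists cards $\sigma(1),\dots,\sigma(n)$ from top to bottom); $U_n$ is the uniform distribution on $S_n$. A rising sequence of $\sigma$ is a maximal set of cards with consecutive face values appearing in increasing order in $\sigma$; $r(\sigma)$ is the number of rising sequences, i.e. $1$ plus the number of $i\in\{1,\dots,n-1\}$ such that card $i+1$ appears before card $i$. For an integer $m\ge1$, an $m$-shuffle cuts the deck into $m$ packs of sizes $(a_1,\dots,a_m)$ with multinomial probability $m^{-n}\frac{n!}{a_1!\cdots a_m!}$, then drops cards one by one, from pack $i$ with probability proportional to its current size. Its distribution $Q_{n,m}$, started from a deck in order, is given by (Bayer–Diaconis) $Q_{n,m}(\sigma)=m^{-n}\binom{n+m-r(\sigma)}{n}$ (the binomial being $0$ if $m<r(\sigma)$), and this may be taken as the definition.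 For a probability $p$ on $\{1,2,\dots\}$, the $p$-shuffle is $Q_{n,p}=\sum_{m\ge1}p(m)Q_{n,m}$. For a probability $Q$ on $S_n$, $Q^k$ is the distribution after $k$ independent successive $Q$-shuffles from a deck in order, i.e. the $k$-fold convolution power of $Q$ on the symmetric group ($Q^0$ is the point mass at the identity). It is known that $Q_{n,m}*Q_{n,m'}=Q_{n,mm'}$. $\|\mu-\nu\|_{\mathrm{TV}}=\sup_{A}\{\mu(A)-\nu(A)\}$. $\log$ is the natural logarithm. *)

theory Defs
  imports "HOL-Probability.Probability" "HOL-Combinatorics.Permutations"
begin

text \<open>
  An arrangement of the deck is a permutation \<open>\<sigma>\<close> of \<open>{1..n}\<close>, where \<open>\<sigma> i\<close> is the card at
  position \<open>i\<close> (counted from the top), so that \<open>inv \<sigma> c\<close> is the position of card \<open>c\<close>.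
  Probability distributions on \<open>arrangements n\<close> are represented by their mass functions;
  values outside \<open>arrangements n\<close> are irrelevant and never used.
\<close>

definition arrangements :: "nat \<Rightarrow> (nat \<Rightarrow> nat) set" where
  "arrangements n = {\<sigma>. \<sigma> permutes {1..n}}"

definition rising_sequences :: "nat \<Rightarrow> (nat \<Rightarrow> nat) \<Rightarrow> nat" where
  "rising_sequences n \<sigma> = 1 + card {i \<in> {1..<n}. inv \<sigma> (i + 1) < inv \<sigma> i}"

text \<open>
  The Bayer--Diaconis formula. The natural-number subtraction does not truncate, since
  \<open>rising_sequences n \<sigma> \<le> max 1 n\<close> and \<open>m \<ge> 1\<close>; for \<open>m < rising_sequences n \<sigma>\<close> the
  binomial coefficient is \<open>0\<close>.
\<close>

definition riffle :: "nat \<Rightarrow> nat \<Rightarrow> (nat \<Rightarrow> nat) \<Rightarrow> real" where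
  "riffle n m \<sigma> = real ((n + m - rising_sequences n \<sigma>) choose n) / real m ^ n"

definition riffle_mix :: "nat \<Rightarrow> nat pmf \<Rightarrow> (nat \<Rightarrow> nat) \<Rightarrow> real" where
  "riffle_mix n p \<sigma> = (\<Sum>\<^sub>\<infinity>m\<in>{1..}. pmf p m * riffle n m \<sigma>)"

definition uniform :: "nat \<Rightarrow> (nat \<Rightarrow> nat) \<Rightarrow> real" where
  "uniform n \<sigma> = 1 / real (card (arrangements n))"

text \<open>
  Shuffling a deck in arrangement \<open>\<tau>\<close> by a shuffle that takes the ordered deck to \<open>\<rho>\<close>
  produces the arrangement \<open>\<tau> \<circ> \<rho>\<close>.
\<close>

definition convolution ::
    "nat \<Rightarrow> ((nat \<Rightarrow> nat) \<Rightarrow> real) \<Rightarrow> ((nat \<Rightarrow> nat) \<Rightarrow> real) \<Rightarrow> (nat \<Rightarrow> nat) \<Rightarrow> real" where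
  "convolution n P Q \<sigma> = (\<Sum>\<tau>\<in>arrangements n. P \<tau> * Q (inv \<tau> \<circ> \<sigma>))"

fun convolution_power ::
    "nat \<Rightarrow> ((nat \<Rightarrow> nat) \<Rightarrow> real) \<Rightarrow> nat \<Rightarrow> (nat \<Rightarrow> nat) \<Rightarrow> real" where
  "convolution_power n Q 0 = (\<lambda>\<sigma>. if \<sigma> = id then 1 else 0)"
| "convolution_power n Q (Suc k) = convolution n (convolution_power n Q k) Q"

definition tv_dist ::
    "nat \<Rightarrow> ((nat \<Rightarrow> nat) \<Rightarrow> real) \<Rightarrow> ((nat \<Rightarrow> nat) \<Rightarrow> real) \<Rightarrow> real" where
  "tv_dist n P Q = (SUP A\<in>Pow (arrangements n). sum P A - sum Q A)"

end

theory Submission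
  imports Defs "HOL-Real_Asymp.Real_Asymp"
begin

text \<open>
  A $p$-shuffle repeated $k$ times is an $M_k$-shuffle with a random number of packs: since an
  $a$-shuffle followed by a $b$-shuffle is an $ab$-shuffle, $Q_{n,p}^k = E[Q_{n,M_k}]$, where $M_k$ is
  a product of $k$ independent samples of $p$. By the law of large numbers $\log M_k$ is close to
  $\mu k$, so the hypotheses on $k_n$ say that, with probability tending to one, $M_{k_n}$ is above
  $n^{3/2 + 2 \gamma}$ in the first half and below $n^{3/2 - 2 \gamma}$ in the second, for some
  $\gamma > 0$. What remains is that $n^{3/2}$ is the threshold for the number of packs of a
  single shuffle.

  \<^bold>\<open>Multiplicativity.\<close> An inverse $m$-shuffle writes an independent uniform digit below $m$ on
  every card and sorts the deck stably; the formula for $Q_{n,m}$ counts the words of digits with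
  a given sorting permutation (\<open>riffle_eq_fibre\<close>). Radix sort by pairs of digits then gives
  $Q_{n,a} * Q_{n,b} = Q_{n,ab}$ (\<open>riffle_mult\<close>).

  \<^bold>\<open>Law of large numbers.\<close> Only the first moment of $\log$ under $p$ is assumed finite.
  The variables $M_k^{-1/k}$ take values in the unit interval, and their moments are powers of
  expectations under $p$; the first two converge to $e^{-\mu}$ and $e^{-2\mu}$, so Chebyshev's inequality gives
  convergence in probability to $e^{-\mu}$ (\<open>iterated_product_law_of_large_numbers\<close>).

  \<^bold>\<open>Threshold.\<close> Write $r$ for the number of rising sequences and $e = n + 1 - 2r$. The density of
  $Q_{n,m}$ against the uniform distribution is $\prod_{i=1}^n (1 + (i - r)/m)$, whose
  logarithm is roughly $ne/(2m) - n^3/(24 m^2)$. Under the uniform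
  distribution $e$ is a sum of signs that are uncorrelated unless adjacent, so $e$ is of order
  $\sqrt n$ (\<open>card_large_ascent_excess\<close>). If $m \ge n^{3/2 + 2 \gamma}$, both
  terms vanish on the bulk of the uniform distribution and the density is at least $1 - o(1)$ there.
  If $m \le n^{3/2 - 2 \gamma}$, the quadratic term dominates wherever $e \le n^{1/2 + \gamma}$;
  this event has uniform probability $1 - o(1)$, and the density is uniformly $o(1)$ on it. So the
  second moment of $e$ under the uniform distribution settles both halves.
\<close>

section \<open>Riffle shuffles and stable sorting of words\<close>

definition words :: "nat \<Rightarrow> nat \<Rightarrow> (nat \<Rightarrow> nat) set" where
  "words n m = {1..n} \<rightarrow>\<^sub>E {..<m}"

text \<open>
  The permutation \<open>\<pi>\<close> that sends every position to its place after the word \<open>w\<close> has been sorted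
  stably. Stating it through comparisons instead of defining \<open>\<pi>\<close> from \<open>w\<close> reduces radix sort below to
  a chain of equivalences.
\<close>
definition sorted_by :: "nat \<Rightarrow> (nat \<Rightarrow> nat) \<Rightarrow> (nat \<Rightarrow> nat) \<Rightarrow> bool" where
  "sorted_by n w \<pi> \<longleftrightarrow>
    (\<forall>i\<in>{1..n}. \<forall>j\<in>{1..n}. \<pi> i < \<pi> j \<longleftrightarrow> w i < w j \<or> (w i = w j \<and> i < j))"

definition fibre :: "nat \<Rightarrow> nat \<Rightarrow> (nat \<Rightarrow> nat) \<Rightarrow> (nat \<Rightarrow> nat) set" where
  "fibre n m \<pi> = {w \<in> words n m. sorted_by n w \<pi>}"

lemma finite_words [simp]: "finite (words n m)"
  by (simp add: words_def finite_PiE)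

lemma card_words: "card (words n m) = m ^ n"
  by (simp add: words_def card_PiE)

lemma finite_fibre [simp]: "finite (fibre n m \<pi>)"
  by (simp add: fibre_def)

lemma finite_arrangements [simp]: "finite (arrangements n)"
  by (simp add: arrangements_def finite_permutations)

lemma card_arrangements: "card (arrangements n) = fact n"
  by (simp add: arrangements_def card_permutations)

lemma arrangements_inv: "\<sigma> \<in> arrangements n \<Longrightarrow> inv \<sigma> \<in> arrangements n"
  by (simp add: arrangements_def permutes_inv)

lemma arrangements_comp:
  "\<sigma> \<in> arrangements n \<Longrightarrow> \<tau> \<in> arrangements n \<Longrightarrow> \<sigma> \<circ> \<tau> \<in> arrangements n"
  by (simp add: arrangements_def permutes_compose)

lemma arrangements_mem: "\<sigma> \<in> arrangements n \<Longrightarrow> \<sigma> i \<in> {1..n} \<longleftrightarrow> i \<in> {1..n}"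
  unfolding arrangements_def by (simp only: mem_Collect_eq permutes_in_image)

lemma arrangements_inverses:
  assumes "\<sigma> \<in> arrangements n"
  shows "\<sigma> (inv \<sigma> i) = i" "inv \<sigma> (\<sigma> i) = i"
  using assms permutes_inverses unfolding arrangements_def by auto

lemma arrangements_outside: "\<sigma> \<in> arrangements n \<Longrightarrow> i \<notin> {1..n} \<Longrightarrow> \<sigma> i = i"
  unfolding arrangements_def by (simp add: permutes_def)

text \<open>
  A permutation is recovered from the comparisons of its values, because \<open>\<pi> i - 1\<close> is the number of
  \<open>j\<close> with \<open>\<pi> j < \<pi> i\<close>.
\<close>
lemma sorted_by_unique:
  assumes "\<pi> \<in> arrangements n" "\<rho> \<in> arrangements n" "sorted_by n w \<pi>" "sorted_by n w \<rho>"
  shows "\<pi> = \<rho>"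
proof -
  have rank: "card {j\<in>{1..n}. \<sigma> j < \<sigma> i} = \<sigma> i - 1"
    if "\<sigma> \<in> arrangements n" "i \<in> {1..n}" for \<sigma> i
  proof -
    have le: "\<sigma> i \<le> n"
      using arrangements_mem[OF that(1), of i] that(2) by auto
    have "{j\<in>{1..n}. \<sigma> j < \<sigma> i} = inv \<sigma> ` {1..<\<sigma> i}"
    proof (intro set_eqI iffI)
      fix j assume "j \<in> {j\<in>{1..n}. \<sigma> j < \<sigma> i}"
      then have "\<sigma> j \<in> {1..<\<sigma> i}" using arrangements_mem[OF that(1), of j] by auto
      then show "j \<in> inv \<sigma> ` {1..<\<sigma> i}"
        using arrangements_inverses(2)[OF that(1), of j] by force
    next
      fix j assume "j \<in> inv \<sigma> ` {1..<\<sigma> i}"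
      then obtain x where x: "j = inv \<sigma> x" "1 \<le> x" "x < \<sigma> i" by auto
      moreover have "inv \<sigma> x \<in> {1..n}"
        using arrangements_mem[OF arrangements_inv[OF that(1)], of x] x le by auto
      ultimately show "j \<in> {j\<in>{1..n}. \<sigma> j < \<sigma> i}"
        using arrangements_inverses(1)[OF that(1), of x] by auto
    qed
    moreover have "inj (inv \<sigma>)"
      using arrangements_inv[OF that(1)] permutes_inj unfolding arrangements_def by blast
    ultimately show ?thesis
      by (simp add: card_image inj_on_subset)
  qed
  show ?thesis
  proof
    fix i
    show "\<pi> i = \<rho> i"
    proof (cases "i \<in> {1..n}")
      case True
      have "{j\<in>{1..n}. \<pi> j < \<pi> i} = {j\<in>{1..n}. \<rho> j < \<rho> i}"
        using assms(3,4) True unfolding sorted_by_def by auto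
      then have "\<pi> i - 1 = \<rho> i - 1"
        using rank[OF assms(1) True] rank[OF assms(2) True] by simp
      moreover have "\<pi> i \<ge> 1" "\<rho> i \<ge> 1"
        using arrangements_mem[OF assms(1), of i] arrangements_mem[OF assms(2), of i] True by auto
      ultimately show ?thesis by simp
    next
      case False
      then show ?thesis using arrangements_outside[OF assms(1)] arrangements_outside[OF assms(2)] by simp
    qed
  qed
qed

text \<open>
  The comparison that breaks ties by position is a strict linear order on positions, so counting
  predecessors ranks them.
\<close>
lemma sorted_by_exists:
  obtains \<pi> where "\<pi> \<in> arrangements n" "sorted_by n w \<pi>"
proof -
  define before where "before i j \<longleftrightarrow> w i < w j \<or> (w i = w j \<and> i < j)" for i j
  define B where "B i = {j\<in>{1..n}. before j i}" for i
  define \<pi> where "\<pi> i = (if i \<in> {1..n} then Suc (card (B i)) else i)" for i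
  have mono: "card (B i) < card (B j)" if "before i j" "i \<in> {1..n}" for i j
  proof (rule psubset_card_mono)
    show "finite (B j)" by (simp add: B_def)
    have "B i \<subseteq> B j" using that by (auto simp: B_def before_def)
    moreover have "i \<in> B j" "i \<notin> B i" using that by (auto simp: B_def before_def)
    ultimately show "B i \<subset> B j" by blast
  qed
  have total: "before i j \<or> before j i" if "i \<noteq> j" for i j
    using that by (auto simp: before_def)
  have iff: "\<pi> i < \<pi> j \<longleftrightarrow> before i j" if "i \<in> {1..n}" "j \<in> {1..n}" for i j
  proof
    assume "\<pi> i < \<pi> j"
    then have "i \<noteq> j" "\<not> before j i" using mono[of j i] that by (auto simp: \<pi>_def)
    then show "before i j" using total by blast
  next
    assume "before i j"
    then show "\<pi> i < \<pi> j" using mono[of i j] that by (simp add: \<pi>_def)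
  qed
  have range: "\<pi> i \<in> {1..n}" if "i \<in> {1..n}" for i
  proof -
    have "B i \<subseteq> {1..n}" "i \<notin> B i" by (auto simp: B_def before_def)
    then have "B i \<subset> {1..n}" using that by blast
    then have "card (B i) < n" using psubset_card_mono[of "{1..n}" "B i"] by simp
    then show ?thesis using that by (simp add: \<pi>_def)
  qed
  have "inj_on \<pi> {1..n}"
  proof (rule inj_onI)
    fix i j assume ij: "i \<in> {1..n}" "j \<in> {1..n}" "\<pi> i = \<pi> j"
    then have "\<not> before i j" "\<not> before j i" using iff[of i j] iff[of j i] by auto
    then show "i = j" using total by blast
  qed
  then have "bij_betw \<pi> {1..n} {1..n}"
    unfolding bij_betw_def using range endo_inj_surj[of "{1..n}" \<pi>] by blast
  then have "\<pi> permutes {1..n}"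
    by (rule bij_imp_permutes) (auto simp: \<pi>_def)
  then show ?thesis
    using that iff unfolding arrangements_def sorted_by_def before_def by blast
qed

lemma sum_card_fibre: "(\<Sum>\<pi>\<in>arrangements n. card (fibre n m \<pi>)) = m ^ n"
proof -
  have "words n m = (\<Union>\<pi>\<in>arrangements n. fibre n m \<pi>)"
    using sorted_by_exists by (auto simp: fibre_def) metis
  moreover have "card (\<Union>\<pi>\<in>arrangements n. fibre n m \<pi>) = (\<Sum>\<pi>\<in>arrangements n. card (fibre n m \<pi>))"
    using sorted_by_unique by (intro card_UN_disjoint) (auto simp: fibre_def)
  ultimately show ?thesis by (metis card_words)
qed

lemma sum_binomial_shift:
  assumes "c \<le> n"
  shows "(\<Sum>x<m. (c + x) choose n) = (c + m) choose Suc n"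
  using assms by (induction m) (auto simp: binomial_eq_0)

text \<open>
  Subtracting from \<open>g j\<close> the gaps required before \<open>j\<close> turns these sequences into multisets, hence
  the binomial coefficient. The proof is by induction on the length: fixing the last value \<open>x\<close>
  leaves the same problem below \<open>Suc x - d n\<close>, and the resulting sum is a hockey-stick sum.
\<close>
lemma card_sequences_with_gaps:
  assumes "1 \<le> n" "\<And>j. d j \<le> (1::nat)"
  shows "card {g \<in> words n m. \<forall>j\<in>{1..<n}. g j + d j \<le> g (Suc j)}
           = (n + m - 1 - (\<Sum>j\<in>{1..<n}. d j)) choose n"
  using assms(1)
proof (induction n arbitrary: m rule: dec_induct)
  case base
  then show ?case by (simp add: card_words)
next
  case (step n)
  let ?G = "\<lambda>n m. {g \<in> words n m. \<forall>j\<in>{1..<n}. g j + d j \<le> g (Suc j)}"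
  let ?D = "\<Sum>j\<in>{1..<n}. d j"
  let ?S = "SIGMA x:{..<m}. ?G n (Suc x - d n)"
  have "?D \<le> card {1..<n}" using sum_mono[of "{1..<n}" d "\<lambda>_. 1"] assms(2) by simp
  then have D: "?D + d n \<le> n" using assms(2)[of n] step.hyps by simp
  have upd: "g(Suc n := x) \<in> ?G (Suc n) m" if "x < m" "g \<in> ?G n (Suc x - d n)" for g x
  proof -
    have gw: "g \<in> {1..n} \<rightarrow>\<^sub>E {..<Suc x - d n}" and gg: "\<forall>j\<in>{1..<n}. g j + d j \<le> g (Suc j)"
      using \<open>g \<in> ?G n (Suc x - d n)\<close> unfolding words_def by blast+
    have small: "g i < Suc x - d n" if "i \<in> {1..n}" for i
      using PiE_mem[OF gw that] by (rule lessThan_iff[THEN iffD1])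
    have top: "g n + d n \<le> x" using small[of n] step.hyps by simp
    have ext: "g i = undefined" if "i \<notin> {1..n}" for i
      using PiE_arb[OF gw that] .
    have "(g(Suc n := x)) \<in> words (Suc n) m"
      unfolding words_def
    proof (rule PiE_I)
      fix i assume "i \<in> {1..Suc n}"
      then show "(g(Suc n := x)) i \<in> {..<m}" using small[of i] \<open>x < m\<close> by auto
    next
      fix i assume "i \<notin> {1..Suc n}"
      then show "(g(Suc n := x)) i = undefined" using ext[of i] by auto
    qed
    moreover have "(g(Suc n := x)) j + d j \<le> (g(Suc n := x)) (Suc j)" if "j \<in> {1..<Suc n}" for j
    proof (cases "j = n")
      case True
      then show ?thesis using top by simp
    next
      case False
      then show ?thesis using bspec[OF gg, of j] that by simp
    qed
    ultimately show ?thesis by blast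
  qed
  have res: "g (Suc n) < m \<and> g(Suc n := undefined) \<in> ?G n (Suc (g (Suc n)) - d n)"
    if "g \<in> ?G (Suc n) m" for g
  proof -
    have w: "g \<in> words (Suc n) m" and gap: "\<And>j. 1 \<le> j \<Longrightarrow> j \<le> n \<Longrightarrow> g j + d j \<le> g (Suc j)"
      using that by auto
    have le: "g j \<le> g n" if "1 \<le> j" "j \<le> n" for j
      using that(2,1)
    proof (induction j rule: inc_induct)
      case (step j)
      then show ?case using gap[of j] by linarith
    qed simp
    have "g n + d n \<le> g (Suc n)" using gap[of n] step.hyps by simp
    then have lt: "g j < Suc (g (Suc n)) - d n" if "1 \<le> j" "j \<le> n" for j
      using le[OF that] by linarith
    have "g(Suc n := undefined) \<in> words n (Suc (g (Suc n)) - d n)"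
      unfolding words_def
    proof (rule PiE_I)
      fix i assume i: "i \<notin> {1..n}"
      show "(g(Suc n := undefined)) i = undefined"
      proof (cases "i = Suc n")
        case False
        then have "i \<notin> {1..Suc n}" using i by auto
        then have "g i = undefined" using w unfolding words_def by (metis PiE_arb)
        then show ?thesis using False by simp
      qed simp
    qed (use lt in auto)
    moreover have "g (Suc n) < m"
      using w PiE_mem[of g "{1..Suc n}" "\<lambda>_. {..<m}" "Suc n"] by (simp add: words_def)
    moreover have "\<forall>j\<in>{1..<n}. (g(Suc n := undefined)) j + d j \<le> (g(Suc n := undefined)) (Suc j)"
    proof
      fix j assume "j \<in> {1..<n}"
      then show "(g(Suc n := undefined)) j + d j \<le> (g(Suc n := undefined)) (Suc j)"
        using gap[of j] by simp
    qed
    ultimately show ?thesis by blast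
  qed
  have "bij_betw (\<lambda>(x, g). g(Suc n := x)) ?S (?G (Suc n) m)"
  proof (rule bij_betw_byWitness[where f' = "\<lambda>g. (g (Suc n), g(Suc n := undefined))"])
    show "\<forall>a\<in>?S. (\<lambda>g. (g (Suc n), g(Suc n := undefined))) ((\<lambda>(x, g). g(Suc n := x)) a) = a"
    proof
      fix a assume "a \<in> ?S"
      then obtain x g where a: "a = (x, g)" and "g \<in> words n (Suc x - d n)" by blast
      then have "g (Suc n) = undefined"
        unfolding words_def by (intro PiE_arb) auto
      then show "(\<lambda>g. (g (Suc n), g(Suc n := undefined))) ((\<lambda>(x, g). g(Suc n := x)) a) = a"
        by (simp add: a fun_upd_idem)
    qed
    show "\<forall>g\<in>?G (Suc n) m. (\<lambda>(x, g). g(Suc n := x)) (g (Suc n), g(Suc n := undefined)) = g"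
      by simp
    show "(\<lambda>(x, g). g(Suc n := x)) ` ?S \<subseteq> ?G (Suc n) m"
    proof (rule image_subsetI)
      fix a assume "a \<in> ?S"
      then obtain x g where "a = (x, g)" "x < m" "g \<in> ?G n (Suc x - d n)" by blast
      then show "(\<lambda>(x, g). g(Suc n := x)) a \<in> ?G (Suc n) m" using upd by (simp only: prod.case)
    qed
    show "(\<lambda>g. (g (Suc n), g(Suc n := undefined))) ` ?G (Suc n) m \<subseteq> ?S"
    proof
      fix a assume "a \<in> (\<lambda>g. (g (Suc n), g(Suc n := undefined))) ` ?G (Suc n) m"
      then obtain g where "a = (g (Suc n), g(Suc n := undefined))" "g \<in> ?G (Suc n) m" by blast
      then show "a \<in> ?S" using res[of g] by blast
    qed
  qed
  then have "card (?G (Suc n) m) = card ?S" by (simp add: bij_betw_same_card)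
  also have "\<dots> = (\<Sum>x<m. card (?G n (Suc x - d n)))" by (simp add: card_SigmaI)
  also have "\<dots> = (\<Sum>x<m. (n + (Suc x - d n) - 1 - ?D) choose n)"
    using step.IH by simp
  also have "\<dots> = (\<Sum>x<m. (n - d n - ?D + x) choose n)"
    using D assms(2)[of n] by (intro sum.cong refl arg_cong2[of _ _ _ _ "(choose)"]) auto
  also have "\<dots> = (n - d n - ?D + m) choose Suc n" by (rule sum_binomial_shift) simp
  also have "n - d n - ?D + m = Suc n + m - 1 - (\<Sum>j\<in>{1..<Suc n}. d j)"
    using D step.hyps by simp
  finally show ?case .
qed

text \<open>
  Reading \<open>w\<close> in sorted order, it suffices to compare neighbours: a tie between places \<open>j\<close> and
  \<open>Suc j\<close> is allowed precisely when \<open>inv \<pi>\<close> ascends there, so every descent of \<open>inv \<pi>\<close> forces a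
  strict increase of the letters.
\<close>
lemma sorted_by_iff_gaps:
  assumes "\<pi> \<in> arrangements n"
  shows "sorted_by n w \<pi> \<longleftrightarrow>
    (\<forall>j\<in>{1..<n}. w (inv \<pi> j) + (if inv \<pi> (Suc j) < inv \<pi> j then 1 else 0) \<le> w (inv \<pi> (Suc j)))"
    (is "_ \<longleftrightarrow> ?gaps")
proof -
  define q where "q = inv \<pi>"
  have q: "q i \<in> {1..n}" "\<pi> (q i) = i" if "i \<in> {1..n}" for i
    using arrangements_mem[OF arrangements_inv[OF assms], of i] that arrangements_inverses[OF assms]
    by (auto simp: q_def)
  have pi: "\<pi> i \<in> {1..n}" "q (\<pi> i) = i" if "i \<in> {1..n}" for i
    using arrangements_mem[OF assms, of i] that arrangements_inverses[OF assms] by (auto simp: q_def)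
  define before where "before i j \<longleftrightarrow> w i < w j \<or> (w i = w j \<and> i < j)" for i j
  have "sorted_by n w \<pi> \<longleftrightarrow> (\<forall>a\<in>{1..n}. \<forall>b\<in>{1..n}. a < b \<longrightarrow> before (q a) (q b))"
  proof
    assume s: "sorted_by n w \<pi>"
    show "\<forall>a\<in>{1..n}. \<forall>b\<in>{1..n}. a < b \<longrightarrow> before (q a) (q b)"
      using s q unfolding sorted_by_def before_def by metis
  next
    assume s: "\<forall>a\<in>{1..n}. \<forall>b\<in>{1..n}. a < b \<longrightarrow> before (q a) (q b)"
    show "sorted_by n w \<pi>"
      unfolding sorted_by_def
    proof (intro ballI)
      fix i j assume ij: "i \<in> {1..n}" "j \<in> {1..n}"
      have "\<pi> i < \<pi> j \<longrightarrow> before i j" "\<pi> j < \<pi> i \<longrightarrow> before j i" "\<pi> i = \<pi> j \<longrightarrow> i = j"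
        using s pi ij by metis+
      then show "(\<pi> i < \<pi> j) = (w i < w j \<or> w i = w j \<and> i < j)"
        by (cases "\<pi> i" "\<pi> j" rule: linorder_cases) (auto simp: before_def)
    qed
  qed
  also have "\<dots> \<longleftrightarrow> (\<forall>j\<in>{1..<n}. before (q j) (q (Suc j)))"
  proof
    assume s: "\<forall>j\<in>{1..<n}. before (q j) (q (Suc j))"
    have "before (q a) (q b)" if "1 \<le> a" "a < b" "b \<le> n" for a b
    proof -
      have "Suc a \<le> b" using that by simp
      then show ?thesis using that(3)
      proof (induction b rule: dec_induct)
        case base
        then show ?case using s that(1) by simp
      next
        case (step b)
        then have "before (q a) (q b)" "before (q b) (q (Suc b))" using s by auto
        then show ?case by (auto simp: before_def)
      qed
    qed
    then show "\<forall>a\<in>{1..n}. \<forall>b\<in>{1..n}. a < b \<longrightarrow> before (q a) (q b)" by simp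
  qed simp
  also have "\<dots> \<longleftrightarrow> ?gaps"
  proof (intro ball_cong refl)
    fix j assume j: "j \<in> {1..<n}"
    then have "q j \<noteq> q (Suc j)" using q(2)[of j] q(2)[of "Suc j"] by force
    then show "before (q j) (q (Suc j)) \<longleftrightarrow>
      w (inv \<pi> j) + (if inv \<pi> (Suc j) < inv \<pi> j then 1 else 0) \<le> w (inv \<pi> (Suc j))"
      by (auto simp: before_def q_def)
  qed
  finally show ?thesis .
qed

lemma words_comp:
  assumes "\<pi> \<in> arrangements n" "w \<in> words n m"
  shows "w \<circ> \<pi> \<in> words n m"
  using assms(2) arrangements_mem[OF assms(1)] arrangements_outside[OF assms(1)]
  by (auto simp: words_def PiE_def Pi_def extensional_def simp del: atLeastAtMost_iff)

text \<open>
  This is the Bayer--Diaconis count: the forced increases are the descents of \<open>inv \<pi>\<close>, of which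
  there is one fewer than there are rising sequences.
\<close>
lemma card_fibre:
  assumes "\<pi> \<in> arrangements n" "1 \<le> n"
  shows "card (fibre n m \<pi>) = (n + m - rising_sequences n \<pi>) choose n"
proof -
  let ?d = "\<lambda>j. if inv \<pi> (Suc j) < inv \<pi> j then 1 else (0::nat)"
  let ?G = "{g \<in> words n m. \<forall>j\<in>{1..<n}. g j + ?d j \<le> g (Suc j)}"
  note inv = arrangements_inv[OF assms(1)] arrangements_inverses[OF assms(1)]
  have "bij_betw (\<lambda>w. w \<circ> inv \<pi>) (fibre n m \<pi>) ?G"
  proof (rule bij_betw_byWitness[where f' = "\<lambda>g. g \<circ> \<pi>"])
    show "(\<lambda>w. w \<circ> inv \<pi>) ` fibre n m \<pi> \<subseteq> ?G"
      using words_comp[OF inv(1)] sorted_by_iff_gaps[OF assms(1)]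
      by (auto simp: fibre_def simp del: atLeastLessThan_iff)
    show "(\<lambda>g. g \<circ> \<pi>) ` ?G \<subseteq> fibre n m \<pi>"
      using words_comp[OF assms(1)] sorted_by_iff_gaps[OF assms(1)] inv(2)
      by (auto simp: fibre_def simp del: atLeastLessThan_iff)
  qed (auto simp: fun_eq_iff inv)
  then have "card (fibre n m \<pi>) = (n + m - 1 - (\<Sum>j\<in>{1..<n}. ?d j)) choose n"
    using card_sequences_with_gaps[OF assms(2), of ?d m] by (simp add: bij_betw_same_card)
  moreover have "(\<Sum>j\<in>{1..<n}. ?d j) = card {j\<in>{1..<n}. inv \<pi> (Suc j) < inv \<pi> j}"
    by (simp add: sum.If_cases Int_def)
  ultimately show ?thesis by (simp add: rising_sequences_def)
qed

lemma riffle_eq_fibre: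
  assumes "\<pi> \<in> arrangements n" "1 \<le> n"
  shows "riffle n m \<pi> = real (card (fibre n m \<pi>)) / real m ^ n"
  by (simp add: riffle_def card_fibre[OF assms])

section \<open>Convolution of riffle shuffles\<close>

text \<open>
  Radix sort. A word over \<open>{..<a * b}\<close> is a word of pairs of digits, ordered lexicographically.
  Sorting it amounts to sorting by the low digits \<open>v\<close>, with permutation \<open>\<rho> = inv \<tau> \<circ> \<sigma>\<close>, and then
  sorting stably by the high digits \<open>u\<close>, listed in the order produced by the first pass. The map
  \<open>?join\<close> below puts the digits back together.
\<close>
lemma card_fibre_mult:
  assumes \<sigma>: "\<sigma> \<in> arrangements n" and b: "1 \<le> b"
  shows "card (fibre n (a * b) \<sigma>) =
    (\<Sum>\<tau>\<in>arrangements n. card (fibre n a \<tau>) * card (fibre n b (inv \<tau> \<circ> \<sigma>)))"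
proof -
  let ?S = "SIGMA \<tau>:arrangements n. fibre n a \<tau> \<times> fibre n b (inv \<tau> \<circ> \<sigma>)"
  let ?join = "\<lambda>(\<tau>, u, v). restrict (\<lambda>i. u ((inv \<tau> \<circ> \<sigma>) i) * b + v i) {1..n}"
  have div_mod: "x < y \<longleftrightarrow> x div b < y div b \<or> (x div b = y div b \<and> x mod b < y mod b)" for x y
    using b by (metis div_le_mono div_mult_mod_eq le_eq_less_or_eq nat_add_left_cancel_less not_less)
  have join: "?join (\<tau>, u, v) \<in> fibre n (a * b) \<sigma>"
    if \<tau>: "\<tau> \<in> arrangements n" and u: "u \<in> fibre n a \<tau>" and v: "v \<in> fibre n b (inv \<tau> \<circ> \<sigma>)" for \<tau> u v
  proof -
    define \<rho> where "\<rho> = inv \<tau> \<circ> \<sigma>"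
    have \<rho>: "\<rho> \<in> arrangements n"
      unfolding \<rho>_def using \<tau> \<sigma> arrangements_inv arrangements_comp by blast
    have \<rho>n: "\<rho> i \<in> {1..n}" if "i \<in> {1..n}" for i using arrangements_mem[OF \<rho>] that by blast
    have \<tau>\<rho>: "\<tau> (\<rho> i) = \<sigma> i" for i using arrangements_inverses[OF \<tau>] by (simp add: \<rho>_def)
    define w where "w = ?join (\<tau>, u, v)"
    have su: "\<forall>i\<in>{1..n}. \<forall>j\<in>{1..n}. \<tau> i < \<tau> j \<longleftrightarrow> u i < u j \<or> (u i = u j \<and> i < j)"
      using u unfolding fibre_def sorted_by_def by blast
    have vb: "v i < b" if "i \<in> {1..n}" for i
      using v that by (auto simp: fibre_def words_def)
    have ua: "u i < a" if "i \<in> {1..n}" for i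
      using u that by (auto simp: fibre_def words_def)
    have w: "w i = u (\<rho> i) * b + v i" if "i \<in> {1..n}" for i
      using that by (simp add: w_def \<rho>_def)
    have wdiv: "w i div b = u (\<rho> i)" "w i mod b = v i" if "i \<in> {1..n}" for i
      using w[OF that] vb[OF that] by auto
    have "w i < a * b" if "i \<in> {1..n}" for i
      using wdiv(1)[OF that] ua[OF \<rho>n[OF that]] b div_less_iff_less_mult[of b "w i" a] by simp
    then have "w \<in> words n (a * b)" by (auto simp: words_def w_def)
    moreover have "sorted_by n w \<sigma>"
      unfolding sorted_by_def
    proof (intro ballI)
      fix i j assume ij: "i \<in> {1..n}" "j \<in> {1..n}"
      have 1: "\<sigma> i < \<sigma> j \<longleftrightarrow> u (\<rho> i) < u (\<rho> j) \<or> (u (\<rho> i) = u (\<rho> j) \<and> \<rho> i < \<rho> j)"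
        using su[rule_format, OF \<rho>n[OF ij(1)] \<rho>n[OF ij(2)]] unfolding \<tau>\<rho> .
      have 2: "\<rho> i < \<rho> j \<longleftrightarrow> v i < v j \<or> (v i = v j \<and> i < j)"
        using v ij unfolding fibre_def sorted_by_def \<rho>_def by blast
      have 3: "w i = w j \<longleftrightarrow> u (\<rho> i) = u (\<rho> j) \<and> v i = v j"
        using wdiv[OF ij(1)] wdiv[OF ij(2)] w[OF ij(1)] w[OF ij(2)] by auto
      show "\<sigma> i < \<sigma> j \<longleftrightarrow> w i < w j \<or> (w i = w j \<and> i < j)"
        using 1 2 3 div_mod[of "w i" "w j"] unfolding wdiv[OF ij(1)] wdiv[OF ij(2)] by blast
    qed
    ultimately show ?thesis by (simp add: fibre_def w_def)
  qed
  have inj: "inj_on ?join ?S"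
  proof (rule inj_onI)
    fix x y assume xy: "x \<in> ?S" "y \<in> ?S" "?join x = ?join y"
    obtain \<tau> u v \<tau>' u' v' where x: "x = (\<tau>, u, v)" and y: "y = (\<tau>', u', v')"
      using prod_cases3 by metis
    have \<tau>: "\<tau> \<in> arrangements n" "\<tau>' \<in> arrangements n"
      and u: "u \<in> fibre n a \<tau>" "u' \<in> fibre n a \<tau>'"
      and v: "v \<in> fibre n b (inv \<tau> \<circ> \<sigma>)" "v' \<in> fibre n b (inv \<tau>' \<circ> \<sigma>)"
      using xy(1,2) unfolding x y by blast+
    have eq: "restrict (\<lambda>i. u ((inv \<tau> \<circ> \<sigma>) i) * b + v i) {1..n} = restrict (\<lambda>i. u' ((inv \<tau>' \<circ> \<sigma>) i) * b + v' i) {1..n}"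
      using xy(3) unfolding x y prod.case .
    have eqi: "u ((inv \<tau> \<circ> \<sigma>) i) * b + v i = u' ((inv \<tau>' \<circ> \<sigma>) i) * b + v' i" if "i \<in> {1..n}" for i
      using fun_cong[OF eq, of i] that by simp
    have vb: "v i < b" "v' i < b" if "i \<in> {1..n}" for i
      using v that by (auto simp: fibre_def words_def)
    have vv: "v i = v' i" and uu: "u ((inv \<tau> \<circ> \<sigma>) i) = u' ((inv \<tau>' \<circ> \<sigma>) i)" if "i \<in> {1..n}" for i
    proof -
      have "(u ((inv \<tau> \<circ> \<sigma>) i) * b + v i) mod b = v i" "(u' ((inv \<tau>' \<circ> \<sigma>) i) * b + v' i) mod b = v' i"
        "(u ((inv \<tau> \<circ> \<sigma>) i) * b + v i) div b = u ((inv \<tau> \<circ> \<sigma>) i)"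
        "(u' ((inv \<tau>' \<circ> \<sigma>) i) * b + v' i) div b = u' ((inv \<tau>' \<circ> \<sigma>) i)"
        using vb[OF that] by auto
      then show "v i = v' i" "u ((inv \<tau> \<circ> \<sigma>) i) = u' ((inv \<tau>' \<circ> \<sigma>) i)"
        using eqi[OF that] by metis+
    qed
    have veq: "v = v'"
      using v vv unfolding fibre_def words_def
      by (intro PiE_ext[of v "{1..n}" "\<lambda>_. {..<b}" v']) auto
    have arr: "inv \<tau> \<circ> \<sigma> \<in> arrangements n" "inv \<tau>' \<circ> \<sigma> \<in> arrangements n"
      using \<tau> \<sigma> arrangements_inv arrangements_comp by blast+
    have \<rho>eq: "inv \<tau> \<circ> \<sigma> = inv \<tau>' \<circ> \<sigma>"
      using sorted_by_unique[OF arr] v veq by (auto simp: fibre_def)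
    have "u i = u' i" if "i \<in> {1..n}" for i
    proof -
      let ?j = "inv (inv \<tau> \<circ> \<sigma>) i"
      have "?j \<in> {1..n}" using arrangements_mem[OF arrangements_inv[OF arr(1)]] that by blast
      moreover have "(inv \<tau> \<circ> \<sigma>) ?j = i" using arrangements_inverses[OF arr(1)] by blast
      ultimately show ?thesis using uu[of ?j] \<rho>eq by metis
    qed
    then have ueq: "u = u'"
      using u unfolding fibre_def words_def
      by (intro PiE_ext[of u "{1..n}" "\<lambda>_. {..<a}" u']) auto
    have "inv \<tau> i = inv \<tau>' i" for i
      using fun_cong[OF \<rho>eq, of "inv \<sigma> i"] arrangements_inverses[OF \<sigma>] by simp
    then have "\<tau> = \<tau>'"
      using arrangements_inverses[OF \<tau>(1)] arrangements_inverses[OF \<tau>(2)] by (metis ext)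
    then show "x = y" unfolding x y using ueq veq by blast
  qed
  have surj: "fibre n (a * b) \<sigma> \<subseteq> ?join ` ?S"
  proof
    fix w assume w: "w \<in> fibre n (a * b) \<sigma>"
    then have sw: "\<forall>i\<in>{1..n}. \<forall>j\<in>{1..n}. \<sigma> i < \<sigma> j \<longleftrightarrow> w i < w j \<or> (w i = w j \<and> i < j)"
      unfolding fibre_def sorted_by_def by blast
    define v where "v = restrict (\<lambda>i. w i mod b) {1..n}"
    obtain \<rho> where \<rho>: "\<rho> \<in> arrangements n" and s: "sorted_by n v \<rho>"
      using sorted_by_exists by blast
    define \<tau> where "\<tau> = \<sigma> \<circ> inv \<rho>"
    have \<tau>: "\<tau> \<in> arrangements n"
      unfolding \<tau>_def using \<rho> \<sigma> arrangements_inv arrangements_comp by blast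
    have \<rho>_eq: "inv \<tau> \<circ> \<sigma> = \<rho>"
    proof
      fix i
      have "\<tau> (\<rho> i) = \<sigma> i" using arrangements_inverses[OF \<rho>] by (simp add: \<tau>_def)
      then show "(inv \<tau> \<circ> \<sigma>) i = \<rho> i" using arrangements_inverses[OF \<tau>] by (metis comp_apply)
    qed
    define u where "u = restrict (\<lambda>i. w i div b) {1..n} \<circ> inv \<rho>"
    have "v \<in> words n b" using b by (auto simp: v_def words_def)
    then have v_fib: "v \<in> fibre n b (inv \<tau> \<circ> \<sigma>)" using s \<rho>_eq by (simp add: fibre_def)
    have "restrict (\<lambda>i. w i div b) {1..n} \<in> words n a"
      unfolding words_def
    proof (rule PiE_I)
      fix i assume i: "i \<in> {1..n}"
      have "w i < a * b"
        using w PiE_mem[of w "{1..n}" "\<lambda>_. {..<a * b}" i] i by (simp add: fibre_def words_def)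
      then show "restrict (\<lambda>i. w i div b) {1..n} i \<in> {..<a}"
        using i by (simp add: less_mult_imp_div_less)
    qed (rule restrict_apply[THEN trans], auto)
    then have "u \<in> words n a"
      unfolding u_def using words_comp arrangements_inv[OF \<rho>] by blast
    moreover have "sorted_by n u \<tau>"
      unfolding sorted_by_def
    proof (intro ballI)
      fix k l assume kl: "k \<in> {1..n}" "l \<in> {1..n}"
      let ?i = "inv \<rho> k" and ?j = "inv \<rho> l"
      have ij: "?i \<in> {1..n}" "?j \<in> {1..n}"
        using arrangements_mem[OF arrangements_inv[OF \<rho>]] kl by blast+
      have \<rho>ij: "\<rho> ?i = k" "\<rho> ?j = l" using arrangements_inverses[OF \<rho>] by auto
      have 1: "\<tau> k < \<tau> l \<longleftrightarrow> w ?i < w ?j \<or> (w ?i = w ?j \<and> ?i < ?j)"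
        using sw[rule_format, OF ij] by (simp add: \<tau>_def)
      have 2: "k < l \<longleftrightarrow> w ?i mod b < w ?j mod b \<or> (w ?i mod b = w ?j mod b \<and> ?i < ?j)"
        using s[unfolded sorted_by_def, rule_format, OF ij] ij \<rho>ij by (simp add: v_def)
      have 3: "w ?i = w ?j \<longleftrightarrow> w ?i div b = w ?j div b \<and> w ?i mod b = w ?j mod b"
        by (metis div_mult_mod_eq)
      have "u k = w ?i div b" "u l = w ?j div b" using ij by (simp_all add: u_def)
      then show "\<tau> k < \<tau> l \<longleftrightarrow> u k < u l \<or> (u k = u l \<and> k < l)"
        using 1 2 3 div_mod[of "w ?i" "w ?j"] by (simp only:) blast
    qed
    ultimately have "u \<in> fibre n a \<tau>" by (simp add: fibre_def)
    moreover have "w = ?join (\<tau>, u, v)"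
    proof
      fix i
      show "w i = ?join (\<tau>, u, v) i"
      proof (cases "i \<in> {1..n}")
        case True
        then show ?thesis using arrangements_inverses[OF \<rho>] by (simp add: \<rho>_eq[unfolded comp_def] u_def v_def fun_cong[OF \<rho>_eq, simplified])
      next
        case False
        then show ?thesis using w by (auto simp: fibre_def words_def)
      qed
    qed
    ultimately show "w \<in> ?join ` ?S" using v_fib \<tau> by blast
  qed
  have "bij_betw ?join ?S (fibre n (a * b) \<sigma>)"
    unfolding bij_betw_def using inj join surj by blast
  then have "card (fibre n (a * b) \<sigma>) = card ?S" by (simp add: bij_betw_same_card)
  then show ?thesis by (simp add: card_SigmaI card_cartesian_product)
qed

lemma riffle_mult:
  assumes "\<sigma> \<in> arrangements n" "1 \<le> b" "1 \<le> n"
  shows "(\<Sum>\<tau>\<in>arrangements n. riffle n a \<tau> * riffle n b (inv \<tau> \<circ> \<sigma>)) = riffle n (a * b) \<sigma>"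
proof -
  have "(\<Sum>\<tau>\<in>arrangements n. riffle n a \<tau> * riffle n b (inv \<tau> \<circ> \<sigma>)) =
    (\<Sum>\<tau>\<in>arrangements n. real (card (fibre n a \<tau>) * card (fibre n b (inv \<tau> \<circ> \<sigma>))) / real (a * b) ^ n)"
    using assms by (intro sum.cong refl)
      (simp add: riffle_eq_fibre arrangements_inv arrangements_comp power_mult_distrib)
  also have "\<dots> = real (card (fibre n (a * b) \<sigma>)) / real (a * b) ^ n"
    using assms by (simp add: card_fibre_mult sum_divide_distrib)
  finally show ?thesis using assms by (simp add: riffle_eq_fibre)
qed

lemma riffle_1:
  assumes "\<sigma> \<in> arrangements n" "1 \<le> n"
  shows "riffle n 1 \<sigma> = (if \<sigma> = id then 1 else 0)"
proof -
  let ?w = "restrict (\<lambda>_. 0::nat) {1..n}"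
  have words: "words n 1 = {?w}"
    by (auto simp: words_def PiE_def Pi_def extensional_def fun_eq_iff)
  have id: "id \<in> arrangements n" by (simp add: arrangements_def permutes_id)
  have "sorted_by n ?w id" by (simp add: sorted_by_def)
  then have "sorted_by n ?w \<sigma> \<longleftrightarrow> \<sigma> = id" using sorted_by_unique[OF assms(1) id] by blast
  then have "fibre n 1 \<sigma> = (if \<sigma> = id then {?w} else {})"
    unfolding fibre_def words by auto
  then show ?thesis using assms by (simp add: riffle_eq_fibre)
qed

lemma riffle_nonneg [simp]: "0 \<le> riffle n m \<sigma>"
  by (simp add: riffle_def)

lemma sum_riffle:
  assumes "1 \<le> m" "1 \<le> n"
  shows "(\<Sum>\<sigma>\<in>arrangements n. riffle n m \<sigma>) = 1"
proof -
  have "(\<Sum>\<sigma>\<in>arrangements n. riffle n m \<sigma>) = real (\<Sum>\<sigma>\<in>arrangements n. card (fibre n m \<sigma>)) / real m ^ n"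
    using assms by (simp add: riffle_eq_fibre sum_divide_distrib)
  also have "\<dots> = 1" using assms by (simp add: sum_card_fibre del: of_nat_sum)
  finally show ?thesis .
qed

lemma riffle_le_1:
  assumes "\<sigma> \<in> arrangements n" "1 \<le> n"
  shows "riffle n m \<sigma> \<le> 1"
proof (cases "m = 0")
  case True
  then show ?thesis using assms by (simp add: riffle_def rising_sequences_def binomial_eq_0)
next
  case False
  have "riffle n m \<sigma> \<le> (\<Sum>\<sigma>\<in>arrangements n. riffle n m \<sigma>)"
    using assms by (intro member_le_sum) auto
  then show ?thesis using sum_riffle[of m n] False assms by simp
qed

section \<open>Iterated mixtures as shuffles with a random number of packs\<close>

lemma expectation_bind_pmf:
  fixes f :: "'a \<Rightarrow> real"
  assumes "\<And>x. \<bar>f x\<bar> \<le> B"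
  shows "measure_pmf.expectation (bind_pmf M N) f =
    measure_pmf.expectation M (\<lambda>x. measure_pmf.expectation (N x) f)"
  unfolding measure_pmf_bind
  by (rule integral_bind[where K="count_space UNIV" and B=B and B'=1])
     (use assms in \<open>auto simp: measure_pmf.finite_measure_axioms measure_pmf_in_subprob_algebra measure_pmf.emeasure_space_1[simplified]\<close>)

lemma integrable_pmf_bounded:
  fixes f :: "'a \<Rightarrow> real"
  assumes "\<And>x. x \<in> set_pmf M \<Longrightarrow> \<bar>f x\<bar> \<le> B"
  shows "integrable (measure_pmf M) f"
  by (rule measure_pmf.integrable_const_bound[where B=B]) (use assms in \<open>auto simp: AE_measure_pmf_iff\<close>)

lemma expectation_pmf_infsum:
  fixes f :: "nat \<Rightarrow> real"
  assumes "pmf p 0 = 0" "Infinite_Set_Sum.abs_summable_on (\<lambda>m. pmf p m * f m) {1..}"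
  shows "integrable (measure_pmf p) f"
    "measure_pmf.expectation p f = (\<Sum>\<^sub>\<infinity>m\<in>{1..}. pmf p m * f m)"
proof -
  have ind: "indicator {1..} m *\<^sub>R (pmf p m * f m) = pmf p m * f m" for m
    using assms(1) by (cases "m = 0") auto
  have ind_fun: "(\<lambda>m. indicator {1..} m *\<^sub>R (pmf p m * f m)) = (\<lambda>m. pmf p m * f m)"
    using ind by (rule ext)
  show "integrable (measure_pmf p) f"
    unfolding measure_pmf_eq_density
    using assms(2) unfolding abs_summable_on_altdef set_integrable_def ind_fun by (simp add: integrable_density)
  have "measure_pmf.expectation p f = integral\<^sup>L (count_space UNIV) (\<lambda>m. pmf p m * f m)"
    unfolding measure_pmf_eq_density by (simp add: integral_density)
  also have "\<dots> = infsetsum (\<lambda>m. pmf p m * f m) {1..}"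
    unfolding infsetsum_altdef set_lebesgue_integral_def ind_fun ..
  also have "\<dots> = (\<Sum>\<^sub>\<infinity>m\<in>{1..}. pmf p m * f m)"
    by (rule infsetsum_infsum) (rule assms(2))
  finally show "measure_pmf.expectation p f = (\<Sum>\<^sub>\<infinity>m\<in>{1..}. pmf p m * f m)" .
qed

primrec iterated_product :: "nat pmf \<Rightarrow> nat \<Rightarrow> nat pmf" where
  "iterated_product p 0 = return_pmf 1"
| "iterated_product p (Suc k) =
     bind_pmf (iterated_product p k) (\<lambda>a. map_pmf (\<lambda>b. a * b) p)"

lemma iterated_product_pos:
  assumes "pmf p 0 = 0" "m \<in> set_pmf (iterated_product p k)"
  shows "1 \<le> m"
  using assms(2)
proof (induction k arbitrary: m)
  case (Suc k)
  then obtain a b where "a \<in> set_pmf (iterated_product p k)" "b \<in> set_pmf p" "m = a * b" by auto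
  moreover from this have "b \<noteq> 0" using assms(1) by (metis set_pmf_iff)
  ultimately show ?case using Suc.IH[of a] by auto
qed simp

lemma riffle_mix_expectation:
  assumes "pmf p 0 = 0" "\<sigma> \<in> arrangements n" "1 \<le> n"
  shows "riffle_mix n p \<sigma> = measure_pmf.expectation p (\<lambda>m. riffle n m \<sigma>)"
proof -
  have "Infinite_Set_Sum.abs_summable_on (\<lambda>m. pmf p m * riffle n m \<sigma>) {1..}"
    by (rule abs_summable_on_comparison_test[of "pmf p"])
      (use riffle_le_1[OF assms(2,3)] in \<open>auto simp: abs_mult mult_left_le\<close>)
  then show ?thesis
    unfolding riffle_mix_def using expectation_pmf_infsum(2)[OF assms(1)] by simp
qed

lemma riffle_bounded: "\<sigma> \<in> arrangements n \<Longrightarrow> 1 \<le> n \<Longrightarrow> \<bar>riffle n m \<sigma>\<bar> \<le> 1"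
  using riffle_le_1 by simp

text \<open>
  Multiplicativity passes to mixtures: convolving the mixtures over \<open>a\<close> and \<open>b\<close> gives the mixture
  over \<open>a * b\<close> of independent \<open>a\<close> and \<open>b\<close>.
\<close>
lemma convolution_power_riffle_mix:
  assumes "pmf p 0 = 0" "1 \<le> n" "\<sigma> \<in> arrangements n"
  shows "convolution_power n (riffle_mix n p) k \<sigma> =
    measure_pmf.expectation (iterated_product p k) (\<lambda>m. riffle n m \<sigma>)"
  using assms(3)
proof (induction k arbitrary: \<sigma>)
  case 0
  then show ?case using riffle_1[OF 0 assms(2)] by simp
next
  case (Suc k)
  let ?M = "iterated_product p k"
  let ?\<rho> = "\<lambda>\<tau>. inv \<tau> \<circ> \<sigma>"
  have \<rho>: "?\<rho> \<tau> \<in> arrangements n" if "\<tau> \<in> arrangements n" for \<tau>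
    using that Suc.prems arrangements_inv arrangements_comp by blast
  have int: "integrable (measure_pmf M) (\<lambda>m. riffle n m \<tau>)" if "\<tau> \<in> arrangements n" for \<tau> M
    using riffle_bounded[OF that assms(2)] by (rule integrable_pmf_bounded)
  have "convolution_power n (riffle_mix n p) (Suc k) \<sigma> =
      (\<Sum>\<tau>\<in>arrangements n. measure_pmf.expectation ?M (\<lambda>a. riffle n a \<tau>) *
         measure_pmf.expectation p (\<lambda>b. riffle n b (?\<rho> \<tau>)))"
    using Suc.IH \<rho> assms(1,2) by (simp add: convolution_def riffle_mix_expectation)
  also have "\<dots> = (\<Sum>\<tau>\<in>arrangements n. measure_pmf.expectation ?M (\<lambda>a.
         measure_pmf.expectation p (\<lambda>b. riffle n a \<tau> * riffle n b (?\<rho> \<tau>))))"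
    by simp
  also have "\<dots> = measure_pmf.expectation ?M (\<lambda>a. \<Sum>\<tau>\<in>arrangements n.
         measure_pmf.expectation p (\<lambda>b. riffle n a \<tau> * riffle n b (?\<rho> \<tau>)))"
    using int by (intro Bochner_Integration.integral_sum[symmetric]) simp
  also have "\<dots> = measure_pmf.expectation ?M (\<lambda>a.
         measure_pmf.expectation p (\<lambda>b. \<Sum>\<tau>\<in>arrangements n. riffle n a \<tau> * riffle n b (?\<rho> \<tau>)))"
    using int[OF \<rho>] by (intro Bochner_Integration.integral_cong refl Bochner_Integration.integral_sum[symmetric]) simp
  also have "\<dots> = measure_pmf.expectation ?M (\<lambda>a. measure_pmf.expectation p (\<lambda>b. riffle n (a * b) \<sigma>))"
  proof (rule Bochner_Integration.integral_cong[OF refl], rule integral_cong_AE)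
    fix a
    show "AE b in measure_pmf p. (\<Sum>\<tau>\<in>arrangements n. riffle n a \<tau> * riffle n b (?\<rho> \<tau>)) = riffle n (a * b) \<sigma>"
    proof (rule AE_pmfI)
      fix b assume "b \<in> set_pmf p"
      then have "b \<noteq> 0" using assms(1) by (metis set_pmf_iff)
      then show "(\<Sum>\<tau>\<in>arrangements n. riffle n a \<tau> * riffle n b (?\<rho> \<tau>)) = riffle n (a * b) \<sigma>"
        using riffle_mult[OF Suc.prems] assms(2) by simp
    qed
  qed auto
  also have "\<dots> = measure_pmf.expectation (iterated_product p (Suc k)) (\<lambda>m. riffle n m \<sigma>)"
    using riffle_bounded[OF Suc.prems assms(2)] by (simp add: expectation_bind_pmf[where B=1])
  finally show ?case .
qed

section \<open>The law of large numbers for products\<close>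

lemma powr_neg_bounds:
  assumes "0 \<le> \<theta>"
  shows "0 \<le> real m powr - \<theta>" "real m powr - \<theta> \<le> 1"
proof -
  show "real m powr - \<theta> \<le> 1"
    using assms by (cases "m = 0") (auto simp: powr_minus ge_one_powr_ge_zero inverse_le_1_iff)
qed simp

lemma expectation_iterated_product_powr:
  assumes "0 \<le> \<theta>"
  shows "measure_pmf.expectation (iterated_product p k) (\<lambda>m. real m powr - \<theta>) =
    measure_pmf.expectation p (\<lambda>m. real m powr - \<theta>) ^ k"
proof (induction k)
  case (Suc k)
  have "measure_pmf.expectation (iterated_product p (Suc k)) (\<lambda>m. real m powr - \<theta>) =
    measure_pmf.expectation (iterated_product p k) (\<lambda>a. measure_pmf.expectation p
       (\<lambda>b. real a powr - \<theta> * real b powr - \<theta>))"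
    using powr_neg_bounds[OF assms] by (simp add: expectation_bind_pmf[where B=1] powr_mult)
  then show ?case using Suc.IH by simp
qed simp

text \<open>
  The bounds \<open>exp (- x / (1 - x)) \<le> 1 - x \<le> exp (- x)\<close> on \<open>[0, 1)\<close>, raised to the power \<open>k\<close>
  at \<open>x = c k / k\<close>, squeeze the sequence.
\<close>
lemma tendsto_power_exp_minus:
  fixes c :: "nat \<Rightarrow> real"
  assumes "\<And>k. 0 \<le> c k" "c \<longlonglongrightarrow> L"
  shows "(\<lambda>k. (1 - c k / real k) ^ k) \<longlonglongrightarrow> exp (- L)"
proof (rule tendsto_sandwich)
  have small: "(\<lambda>k. c k / real k) \<longlonglongrightarrow> 0"
    by (rule tendsto_divide_0[OF assms(2)]) (rule filterlim_at_top_imp_at_infinity, rule filterlim_real_sequentially)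
  then have ev: "\<forall>\<^sub>F k in sequentially. c k / real k < 1" by (rule order_tendstoD) simp
  show "\<forall>\<^sub>F k in sequentially. exp (- (c k / (1 - c k / real k))) \<le> (1 - c k / real k) ^ k"
    using ev eventually_gt_at_top[of 0]
  proof eventually_elim
    case (elim k)
    define x where "x = c k / real k"
    have x: "x < 1" "0 \<le> x" "c k = real k * x" using elim assms(1)[of k] by (auto simp: x_def)
    have "1 / (1 - x) \<le> exp (x / (1 - x))"
      using exp_ge_add_one_self[of "x / (1 - x)"] x by (simp add: field_simps)
    then have "exp (- (x / (1 - x))) \<le> 1 - x"
      using x by (simp add: exp_minus field_simps)
    then have "exp (- (x / (1 - x))) ^ k \<le> (1 - x) ^ k" by (intro power_mono) auto
    then show ?case using x by (simp add: x_def[symmetric] exp_of_nat_mult[symmetric])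
  qed
  show "\<forall>\<^sub>F k in sequentially. (1 - c k / real k) ^ k \<le> exp (- c k)"
    using ev eventually_gt_at_top[of 0]
  proof eventually_elim
    case (elim k)
    define x where "x = c k / real k"
    have x: "x < 1" "0 \<le> x" "c k = real k * x" using elim assms(1)[of k] by (auto simp: x_def)
    have "(1 - x) ^ k \<le> exp (- x) ^ k"
      using exp_ge_add_one_self[of "-x"] x by (intro power_mono) auto
    then show ?case using x by (simp add: x_def[symmetric] exp_of_nat_mult[symmetric])
  qed
  show "(\<lambda>k. exp (- c k)) \<longlonglongrightarrow> exp (- L)" by (intro tendsto_intros assms)
  show "(\<lambda>k. exp (- (c k / (1 - c k / real k)))) \<longlonglongrightarrow> exp (- L)"
    using tendsto_minus[OF tendsto_divide[OF assms(2) tendsto_diff[OF tendsto_const[of 1] small]]]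
    by (intro tendsto_exp) simp
qed

lemma scaled_one_minus_exp:
  assumes "0 \<le> x" "0 < k"
  shows "x / (1 + x / real k) \<le> real k * (1 - exp (- (x / real k)))"
    "real k * (1 - exp (- (x / real k))) \<le> x"
proof -
  define y where "y = x / real k"
  have y: "0 \<le> y" "x = real k * y" using assms by (auto simp: y_def)
  have "1 - exp (- y) \<le> y" using exp_ge_add_one_self[of "-y"] by simp
  then show "real k * (1 - exp (- (x / real k))) \<le> x" using y assms by (simp add: y_def[symmetric])
  have "exp (- y) \<le> 1 / (1 + y)"
    using exp_ge_add_one_self[of y] y by (simp add: exp_minus field_simps)
  then have "y / (1 + y) \<le> 1 - exp (- y)" using y by (simp add: field_simps)
  then have "real k * (y / (1 + y)) \<le> real k * (1 - exp (- y))" by (intro mult_left_mono) auto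
  then show "x / (1 + x / real k) \<le> real k * (1 - exp (- (x / real k)))"
    using y by (simp add: y_def[symmetric])
qed

text \<open>
  These are the Laplace transforms of the averages of \<open>k\<close> independent logarithms. Convergence needs
  only a finite first moment: \<open>k * (1 - m powr (- \<theta> / k))\<close> tends to \<open>\<theta> * ln m\<close> and is dominated
  by it.
\<close>
lemma powr_expectation_limit:
  assumes p0: "pmf p 0 = 0" and int: "integrable (measure_pmf p) (\<lambda>m. ln (real m))" and \<theta>: "0 \<le> \<theta>"
  shows "(\<lambda>k. measure_pmf.expectation p (\<lambda>m. real m powr - (\<theta> / real k)) ^ k) \<longlonglongrightarrow>
    exp (- (\<theta> * measure_pmf.expectation p (\<lambda>m. ln (real m))))"
proof -
  define c where "c k = measure_pmf.expectation p (\<lambda>m. real k * (1 - real m powr - (\<theta> / real k)))" for k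
  have intp: "integrable (measure_pmf p) (\<lambda>m. real m powr - (\<theta> / real k))" for k
    using powr_neg_bounds[of "\<theta> / real k"] \<theta> by (intro integrable_pmf_bounded[where B=1]) auto
  have c_nonneg: "0 \<le> c k" for k
    unfolding c_def using powr_neg_bounds[of "\<theta> / real k"] \<theta> by (intro Bochner_Integration.integral_nonneg) auto
  have pos: "1 \<le> m" if "m \<in> set_pmf p" for m
    using that p0 by (metis One_nat_def Suc_leI neq0_conv set_pmf_iff)
  have powr: "real m powr - (\<theta> / real k) = exp (- ((\<theta> * ln (real m)) / real k))" if "1 \<le> m" for m k
    using that by (simp add: powr_def)
  have "c \<longlonglongrightarrow> measure_pmf.expectation p (\<lambda>m. \<theta> * ln (real m))"
    unfolding c_def
  proof (rule integral_dominated_convergence[where w="\<lambda>m. \<theta> * ln (real m)"])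
    show "AE m in measure_pmf p. (\<lambda>k. real k * (1 - real m powr - (\<theta> / real k))) \<longlonglongrightarrow> \<theta> * ln (real m)"
    proof (rule AE_pmfI)
      fix m assume "m \<in> set_pmf p"
      then have m: "1 \<le> m" by (rule pos)
      define x where "x = \<theta> * ln (real m)"
      have x: "0 \<le> x" using m \<theta> by (simp add: x_def)
      have "(\<lambda>k. x / (1 + x / real k)) \<longlonglongrightarrow> x / (1 + 0)"
        by (intro tendsto_intros lim_const_over_n) simp
      then have lim: "(\<lambda>k. x / (1 + x / real k)) \<longlonglongrightarrow> x" by simp
      have "(\<lambda>k. real k * (1 - exp (- (x / real k)))) \<longlonglongrightarrow> x"
        by (rule tendsto_sandwich[OF
              eventually_mono[OF eventually_gt_at_top[of 0] scaled_one_minus_exp(1)[OF x]]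
              eventually_mono[OF eventually_gt_at_top[of 0] scaled_one_minus_exp(2)[OF x]]
              lim tendsto_const])
      then show "(\<lambda>k. real k * (1 - real m powr - (\<theta> / real k))) \<longlonglongrightarrow> \<theta> * ln (real m)"
        by (simp only: powr[OF m] x_def)
    qed
    show "AE m in measure_pmf p. norm (real k * (1 - real m powr - (\<theta> / real k))) \<le> \<theta> * ln (real m)" for k
    proof (rule AE_pmfI)
      fix m assume "m \<in> set_pmf p"
      then have m: "1 \<le> m" by (rule pos)
      have nn: "0 \<le> \<theta> * ln (real m)" using m \<theta> by simp
      have "0 \<le> real k * (1 - real m powr - (\<theta> / real k))"
        using powr_neg_bounds(2)[of "\<theta> / real k" m] \<theta> by simp
      then show "norm (real k * (1 - real m powr - (\<theta> / real k))) \<le> \<theta> * ln (real m)"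
        using scaled_one_minus_exp(2)[OF nn, of k] nn unfolding powr[OF m] by (cases "k = 0") auto
    qed
  qed (use int in auto)
  then have "(\<lambda>k. (1 - c k / real k) ^ k) \<longlonglongrightarrow> exp (- (\<theta> * measure_pmf.expectation p (\<lambda>m. ln (real m))))"
    using tendsto_power_exp_minus[OF c_nonneg] int by simp
  moreover have "\<forall>\<^sub>F k in sequentially. (1 - c k / real k) ^ k =
      measure_pmf.expectation p (\<lambda>m. real m powr - (\<theta> / real k)) ^ k"
    using eventually_gt_at_top[of 0]
  proof eventually_elim
    case (elim k)
    have "c k = real k * (1 - measure_pmf.expectation p (\<lambda>m. real m powr - (\<theta> / real k)))"
      unfolding c_def using Bochner_Integration.integral_diff[OF _ intp[of k], of "\<lambda>_. 1"]
      by (simp add: measure_pmf.prob_space[simplified])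
    then show ?case using elim by simp
  qed
  ultimately show ?thesis by (rule Lim_transform_eventually)
qed

text \<open>
  The first two moments of \<open>m powr (- 1 / k)\<close> under the \<open>k\<close>-fold product tend to \<open>exp (- \<mu>)\<close> and
  \<open>exp (- 2 * \<mu>)\<close>, so the second moment about \<open>exp (- \<mu>)\<close> vanishes in the limit, and Chebyshev's
  inequality applies. Passing to a bounded decreasing function of \<open>ln m\<close> avoids truncation of the
  unbounded summands.
\<close>
lemma iterated_product_root_concentrates:
  assumes p0: "pmf p 0 = 0" and int: "integrable (measure_pmf p) (\<lambda>m. ln (real m))"
    and \<mu>: "\<mu> = measure_pmf.expectation p (\<lambda>m. ln (real m))" and c: "0 < c"
  shows "(\<lambda>k. measure_pmf.prob (iterated_product p k) {m. c \<le> \<bar>real m powr - (1 / real k) - exp (- \<mu>)\<bar>})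
    \<longlonglongrightarrow> 0"
proof (rule tendsto_sandwich[where f="\<lambda>_. 0"])
  let ?M = "iterated_product p"
  let ?W = "\<lambda>k m. real m powr - (1 / real k)"
  let ?E1 = "\<lambda>k. measure_pmf.expectation p (\<lambda>m. real m powr - (1 / real k)) ^ k"
  let ?E2 = "\<lambda>k. measure_pmf.expectation p (\<lambda>m. real m powr - (2 / real k)) ^ k"
  define v where "v = exp (- \<mu>)"
  have "(\<lambda>k. (?E2 k - 2 * v * ?E1 k + v\<^sup>2) / c\<^sup>2) \<longlonglongrightarrow> (exp (- (2 * \<mu>)) - 2 * v * exp (- (1 * \<mu>)) + v\<^sup>2) / c\<^sup>2"
    unfolding \<mu> using c by (intro tendsto_intros powr_expectation_limit p0 int) auto
  moreover have "exp (- (2 * \<mu>)) - 2 * v * exp (- (1 * \<mu>)) + v\<^sup>2 = 0"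
    by (simp add: v_def power2_eq_square exp_add[symmetric])
  ultimately show "(\<lambda>k. (?E2 k - 2 * v * ?E1 k + v\<^sup>2) / c\<^sup>2) \<longlonglongrightarrow> 0" by simp
  show "\<forall>\<^sub>F k in sequentially. measure_pmf.prob (?M k) {m. c \<le> \<bar>?W k m - exp (- \<mu>)\<bar>} \<le> (?E2 k - 2 * v * ?E1 k + v\<^sup>2) / c\<^sup>2"
  proof (rule always_eventually, rule allI)
    fix k
    have b: "0 \<le> ?W k m" "?W k m \<le> 1" for m using powr_neg_bounds[of "1 / real k" m] by auto
    have sq: "(?W k m)\<^sup>2 = real m powr - (2 / real k)" for m
      by (cases "m = 0") (simp_all add: powr_def power2_eq_square exp_add[symmetric])
    have i1: "integrable (measure_pmf (?M k)) (?W k)"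
      using b by (intro integrable_pmf_bounded[where B=1]) auto
    have i2: "integrable (measure_pmf (?M k)) (\<lambda>m. (?W k m)\<^sup>2)"
      using b by (intro integrable_pmf_bounded[where B=1]) (auto simp: power_le_one)
    have expand: "(?W k m - v)\<^sup>2 = (?W k m)\<^sup>2 - 2 * v * ?W k m + v\<^sup>2" for m
      by (simp add: power2_eq_square algebra_simps)
    have i3: "integrable (measure_pmf (?M k)) (\<lambda>m. (?W k m - v)\<^sup>2)"
      unfolding expand using i1 i2 by auto
    have "measure_pmf.expectation (?M k) (\<lambda>m. (?W k m - v)\<^sup>2) =
        measure_pmf.expectation (?M k) (\<lambda>m. (?W k m)\<^sup>2) - 2 * v * measure_pmf.expectation (?M k) (?W k) + v\<^sup>2"
      unfolding expand using i1 i2 by (simp add: measure_pmf.prob_space[simplified])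
    also have "\<dots> = ?E2 k - 2 * v * ?E1 k + v\<^sup>2"
      unfolding sq by (simp add: expectation_iterated_product_powr)
    finally have E: "measure_pmf.expectation (?M k) (\<lambda>m. (?W k m - v)\<^sup>2) = ?E2 k - 2 * v * ?E1 k + v\<^sup>2" .
    have "measure_pmf.prob (?M k) {m. c \<le> \<bar>?W k m - v\<bar>} = measure_pmf.prob (?M k) {m. c\<^sup>2 \<le> (?W k m - v)\<^sup>2}"
      using c by (intro arg_cong2[where f=measure] refl) (auto simp: abs_le_square_iff[symmetric])
    also have "\<dots> \<le> measure_pmf.expectation (?M k) (\<lambda>m. (?W k m - v)\<^sup>2) / c\<^sup>2"
      using integral_Markov_inequality_measure[OF i3, of "{}" "c\<^sup>2"] c by simp
    finally show "measure_pmf.prob (?M k) {m. c \<le> \<bar>?W k m - exp (- \<mu>)\<bar>} \<le> (?E2 k - 2 * v * ?E1 k + v\<^sup>2) / c\<^sup>2"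
      unfolding E unfolding v_def .
  qed
qed auto

lemma iterated_product_law_of_large_numbers:
  assumes p0: "pmf p 0 = 0" and int: "integrable (measure_pmf p) (\<lambda>m. ln (real m))"
    and \<mu>: "\<mu> = measure_pmf.expectation p (\<lambda>m. ln (real m))" and \<delta>: "0 < \<delta>"
  shows "(\<lambda>k. measure_pmf.prob (iterated_product p k) {m. real m < exp ((\<mu> - \<delta>) * real k)}) \<longlonglongrightarrow> 0" (is "?A")
    and "(\<lambda>k. measure_pmf.prob (iterated_product p k) {m. exp ((\<mu> + \<delta>) * real k) < real m}) \<longlonglongrightarrow> 0" (is "?B")
proof -
  have W: "real m powr - (1 / real k) = exp (- (ln (real m) / real k))" if "1 \<le> m" for m k
    using that by (simp add: powr_def)
  have le: "\<forall>\<^sub>F k in sequentially. measure_pmf.prob (iterated_product p k) {m. P k m}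
      \<le> measure_pmf.prob (iterated_product p k) {m. c \<le> \<bar>real m powr - (1 / real k) - exp (- \<mu>)\<bar>}"
    if "\<And>k m. 0 < k \<Longrightarrow> 1 \<le> m \<Longrightarrow> P k m \<Longrightarrow> c \<le> \<bar>real m powr - (1 / real k) - exp (- \<mu>)\<bar>" for P c
    using eventually_gt_at_top[of 0]
  proof eventually_elim
    case (elim k)
    show ?case
      using that[OF elim] iterated_product_pos[OF p0]
      by (intro measure_pmf.finite_measure_mono_AE) (auto simp: AE_measure_pmf_iff)
  qed
  show ?A
  proof (rule tendsto_sandwich[OF _ le tendsto_const iterated_product_root_concentrates[OF p0 int \<mu>]])
    show "0 < exp (- (\<mu> - \<delta>)) - exp (- \<mu>)" using \<delta> by simp
    fix k m :: nat assume "0 < k" "1 \<le> m" "real m < exp ((\<mu> - \<delta>) * real k)"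
    then have "ln (real m) < (\<mu> - \<delta>) * real k" by (metis ln_less_cancel_iff ln_exp exp_gt_zero of_nat_0_less_iff less_le_trans zero_less_one)
    then have "ln (real m) / real k < \<mu> - \<delta>" using \<open>0 < k\<close> by (simp add: field_simps)
    then have "exp (- (\<mu> - \<delta>)) \<le> exp (- (ln (real m) / real k))" by simp
    then show "exp (- (\<mu> - \<delta>)) - exp (- \<mu>) \<le> \<bar>real m powr - (1 / real k) - exp (- \<mu>)\<bar>"
      using W[OF \<open>1 \<le> m\<close>, of k] by linarith
  qed auto
  show ?B
  proof (rule tendsto_sandwich[OF _ le tendsto_const iterated_product_root_concentrates[OF p0 int \<mu>]])
    show "0 < exp (- \<mu>) - exp (- (\<mu> + \<delta>))" using \<delta> by simp
    fix k m :: nat assume "0 < k" "1 \<le> m" "exp ((\<mu> + \<delta>) * real k) < real m"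
    then have "(\<mu> + \<delta>) * real k < ln (real m)" by (metis ln_less_cancel_iff ln_exp exp_gt_zero of_nat_0_less_iff less_le_trans zero_less_one)
    then have "\<mu> + \<delta> < ln (real m) / real k" using \<open>0 < k\<close> by (simp add: field_simps)
    then have "exp (- (ln (real m) / real k)) \<le> exp (- (\<mu> + \<delta>))" by simp
    then show "exp (- \<mu>) - exp (- (\<mu> + \<delta>)) \<le> \<bar>real m powr - (1 / real k) - exp (- \<mu>)\<bar>"
      using W[OF \<open>1 \<le> m\<close>, of k] by linarith
  qed auto
qed

text \<open>
  Multiplying by a positive integer cannot decrease the number of packs. This lets the lower bound of
  the theorem cover sequences \<open>k n\<close> that stay bounded or oscillate, to which the law of large numbers
  does not apply directly.
\<close>
lemma iterated_product_tail_mono: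
  assumes p0: "pmf p 0 = 0" and "k \<le> l"
  shows "measure_pmf.prob (iterated_product p k) {m. x < real m} \<le>
    measure_pmf.prob (iterated_product p l) {m. x < real m}"
  using assms(2)
proof (induction l rule: dec_induct)
  case (step l)
  let ?S = "{m. x < real m}"
  have bound: "\<bar>indicator ?S m :: real\<bar> \<le> 1" for m by (simp split: split_indicator)
  have "measure_pmf.prob (iterated_product p l) ?S = measure_pmf.expectation (iterated_product p l) (indicator ?S)"
    by simp
  also have "\<dots> \<le> measure_pmf.expectation (iterated_product p l)
      (\<lambda>a. measure_pmf.expectation p (\<lambda>b. indicator ?S (a * b)))"
  proof (rule integral_mono)
    show "integrable (measure_pmf (iterated_product p l)) (indicator ?S :: nat \<Rightarrow> real)"
      by (rule integrable_pmf_bounded[where B=1]) (auto split: split_indicator)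
    have "\<bar>measure_pmf.expectation p (\<lambda>b. indicator ?S (a * b) :: real)\<bar> \<le> 1" for a
    proof -
      have "measure_pmf.expectation p (\<lambda>b. indicator ?S (a * b) :: real) =
          measure_pmf.prob (map_pmf (\<lambda>b. a * b) p) ?S" by (simp flip: integral_map_pmf)
      then show ?thesis by simp
    qed
    then show "integrable (measure_pmf (iterated_product p l)) (\<lambda>a. measure_pmf.expectation p (\<lambda>b. indicator ?S (a * b) :: real))"
      by (rule integrable_pmf_bounded)
    fix a
    have "measure_pmf.expectation p (\<lambda>_. indicator ?S a :: real) \<le> measure_pmf.expectation p (\<lambda>b. indicator ?S (a * b))"
    proof (rule integral_mono_AE)
      show "AE b in measure_pmf p. (indicator ?S a :: real) \<le> indicator ?S (a * b)"
      proof (rule AE_pmfI)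
        fix b assume "b \<in> set_pmf p"
        then have "1 \<le> b" using p0 by (metis One_nat_def Suc_leI neq0_conv set_pmf_iff)
        then have "a \<le> a * b" by simp
        then have "real a \<le> real (a * b)" by (rule of_nat_mono)
        then show "(indicator ?S a :: real) \<le> indicator ?S (a * b)" by (auto split: split_indicator)
      qed
    qed (auto intro!: integrable_pmf_bounded[where B=1] split: split_indicator)
    then show "(indicator ?S a :: real) \<le> measure_pmf.expectation p (\<lambda>b. indicator ?S (a * b))"
      by (simp add: measure_pmf.prob_space[simplified])
  qed
  also have "\<dots> = measure_pmf.expectation (iterated_product p (Suc l)) (indicator ?S)"
    by (simp only: iterated_product.simps expectation_bind_pmf[OF bound] integral_map_pmf)
  also have "\<dots> = measure_pmf.prob (iterated_product p (Suc l)) ?S" by simp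
  finally show ?case using step.IH by linarith
qed simp

section \<open>Rising sequences of a uniform arrangement\<close>

definition step_sign :: "(nat \<Rightarrow> nat) \<Rightarrow> nat \<Rightarrow> real" where
  "step_sign \<sigma> i = (if inv \<sigma> (Suc i) < inv \<sigma> i then - 1 else 1)"

text \<open>
  The number of ascents minus the number of descents of \<open>inv \<sigma>\<close>. It is an affine function of the
  number of rising sequences that is centred under the uniform distribution.
\<close>
definition ascent_excess :: "nat \<Rightarrow> (nat \<Rightarrow> nat) \<Rightarrow> real" where
  "ascent_excess n \<sigma> = (\<Sum>i\<in>{1..<n}. step_sign \<sigma> i)"

lemma ascent_excess_rising_sequences:
  assumes "1 \<le> n"
  shows "ascent_excess n \<sigma> = real n + 1 - 2 * real (rising_sequences n \<sigma>)"
proof -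
  let ?D = "{i \<in> {1..<n}. inv \<sigma> (Suc i) < inv \<sigma> i}"
  have "step_sign \<sigma> i = 1 - 2 * (if i \<in> ?D then 1 else 0)" if "i \<in> {1..<n}" for i
    using that by (simp add: step_sign_def)
  then have "ascent_excess n \<sigma> = (\<Sum>i\<in>{1..<n}. 1 - 2 * (if i \<in> ?D then 1 else 0))"
    unfolding ascent_excess_def by (rule sum.cong[OF refl])
  also have "\<dots> = real (card {1..<n}) - 2 * (\<Sum>i\<in>{1..<n}. if i \<in> ?D then 1 else 0)"
    by (simp only: sum_subtractf sum_distrib_left[symmetric] sum_constant mult_1_right)
  also have "(\<Sum>i\<in>{1..<n}. if i \<in> ?D then 1 else 0) = real (card ?D)"
    by (subst sum.inter_restrict[symmetric]) (auto intro!: arg_cong[where f=card])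
  also have "real (card {1..<n}) = real n - 1" using assms by simp
  finally show ?thesis by (simp add: rising_sequences_def)
qed

lemma rising_sequences_bounds:
  assumes "1 \<le> n"
  shows "1 \<le> rising_sequences n \<sigma>" "rising_sequences n \<sigma> \<le> n"
proof -
  have "card {i \<in> {1..<n}. inv \<sigma> (i + 1) < inv \<sigma> i} \<le> card {1..<n}"
    by (rule card_mono) auto
  then show "rising_sequences n \<sigma> \<le> n" using assms unfolding rising_sequences_def by simp
qed (simp add: rising_sequences_def)

text \<open>
  Exchanging the cards \<open>j\<close> and \<open>j + 1\<close> is an involution on arrangements that flips the sign at \<open>j\<close>
  and leaves the sign at \<open>i\<close> alone, since \<open>i\<close> and \<open>i + 1\<close> are both different from \<open>j\<close> and \<open>j + 1\<close>.
\<close>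
lemma sum_step_sign_uncorrelated:
  assumes "1 \<le> i" "Suc i < j" "j < n"
  shows "(\<Sum>\<sigma>\<in>arrangements n. step_sign \<sigma> i * step_sign \<sigma> j) = 0"
proof -
  let ?t = "Transposition.transpose j (Suc j)"
  \<comment> \<open>Composition on the left acts on card values.\<close>
  let ?\<phi> = "\<lambda>\<sigma>. ?t \<circ> \<sigma>"
  have t: "?t \<in> arrangements n"
    using assms by (auto simp: arrangements_def intro!: permutes_swap_id)
  have "bij_betw ?\<phi> (arrangements n) (arrangements n)"
    by (rule bij_betw_byWitness[where f'="?\<phi>"])
       (use arrangements_comp[OF t] in \<open>auto simp: fun_eq_iff\<close>)
  then have "(\<Sum>\<sigma>\<in>arrangements n. step_sign \<sigma> i * step_sign \<sigma> j) =
      (\<Sum>\<sigma>\<in>arrangements n. step_sign (?\<phi> \<sigma>) i * step_sign (?\<phi> \<sigma>) j)"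
    by (rule sum.reindex_bij_betw[symmetric])
  also have "\<dots> = (\<Sum>\<sigma>\<in>arrangements n. - (step_sign \<sigma> i * step_sign \<sigma> j))"
  proof (rule sum.cong[OF refl])
    fix \<sigma> assume \<sigma>: "\<sigma> \<in> arrangements n"
    then have bij: "bij \<sigma>" by (simp add: arrangements_def permutes_bij)
    then have inv: "inv (?\<phi> \<sigma>) = inv \<sigma> \<circ> ?t"
      by (simp add: o_inv_distrib)
    have "inv \<sigma> j \<noteq> inv \<sigma> (Suc j)"
      using arrangements_inverses(1)[OF \<sigma>] by (metis n_not_Suc_n)
    then have "step_sign (?\<phi> \<sigma>) j = - step_sign \<sigma> j"
      by (auto simp: step_sign_def inv)
    moreover have "step_sign (?\<phi> \<sigma>) i = step_sign \<sigma> i"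
      using assms by (simp add: step_sign_def inv Transposition.transpose_def)
    ultimately show "step_sign (?\<phi> \<sigma>) i * step_sign (?\<phi> \<sigma>) j = - (step_sign \<sigma> i * step_sign \<sigma> j)"
      by simp
  qed
  finally show ?thesis by (simp add: sum_negf)
qed

text \<open>
  Only the at most three indices \<open>j\<close> next to \<open>i\<close> contribute to the second moment, so it is linear in
  \<open>n\<close>.
\<close>
lemma sum_ascent_excess_sq:
  "(\<Sum>\<sigma>\<in>arrangements n. (ascent_excess n \<sigma>)\<^sup>2) \<le> 3 * real n * fact n"
proof -
  let ?c = "\<lambda>i j. \<Sum>\<sigma>\<in>arrangements n. step_sign \<sigma> i * step_sign \<sigma> j"
  have c: "?c i j \<le> (if j \<in> {i - 1..i + 1} then fact n else 0)"
    if "i \<in> {1..<n}" "j \<in> {1..<n}" for i j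
  proof (cases "j \<in> {i - 1..i + 1}")
    case True
    have "?c i j \<le> (\<Sum>\<sigma>\<in>arrangements n. 1)"
      by (rule sum_mono) (simp add: step_sign_def)
    then show ?thesis using True by (simp add: card_arrangements)
  next
    case False
    then have "Suc i < j \<or> Suc j < i" by auto
    then have "?c i j = 0"
    proof
      assume "Suc i < j"
      then show ?thesis using that by (intro sum_step_sign_uncorrelated) auto
    next
      assume "Suc j < i"
      then have "?c j i = 0" using that by (intro sum_step_sign_uncorrelated) auto
      then show ?thesis by (simp add: mult.commute)
    qed
    then show ?thesis using False by simp
  qed
  have "(\<Sum>\<sigma>\<in>arrangements n. (ascent_excess n \<sigma>)\<^sup>2) =
      (\<Sum>\<sigma>\<in>arrangements n. \<Sum>i\<in>{1..<n}. \<Sum>j\<in>{1..<n}. step_sign \<sigma> i * step_sign \<sigma> j)"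
    by (simp add: ascent_excess_def power2_eq_square sum_product)
  also have "\<dots> = (\<Sum>i\<in>{1..<n}. \<Sum>\<sigma>\<in>arrangements n. \<Sum>j\<in>{1..<n}. step_sign \<sigma> i * step_sign \<sigma> j)"
    by (rule sum.swap)
  also have "\<dots> = (\<Sum>i\<in>{1..<n}. \<Sum>j\<in>{1..<n}. ?c i j)"
    by (intro sum.cong refl sum.swap)
  also have "\<dots> \<le> (\<Sum>i\<in>{1..<n}. 3 * fact n)"
  proof (rule sum_mono)
    fix i assume i: "i \<in> {1..<n}"
    have "(\<Sum>j\<in>{1..<n}. ?c i j) \<le> (\<Sum>j\<in>{1..<n}. if j \<in> {i - 1..i + 1} then fact n else 0)"
      using c[OF i] by (rule sum_mono)
    also have "\<dots> = (\<Sum>j\<in>{1..<n} \<inter> {i - 1..i + 1}. fact n)"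
      by (rule sum.inter_restrict[symmetric]) simp
    also have "\<dots> = real (card ({1..<n} \<inter> {i - 1..i + 1})) * fact n" by simp
    also have "\<dots> \<le> 3 * fact n"
    proof -
      have "card ({1..<n} \<inter> {i - 1..i + 1}) \<le> card {i - 1..i + 1}" by (rule card_mono) auto
      then show ?thesis using i by (intro mult_right_mono) auto
    qed
    finally show "(\<Sum>j\<in>{1..<n}. ?c i j) \<le> 3 * fact n" .
  qed
  also have "\<dots> = real (n - 1) * (3 * fact n)" by simp
  also have "\<dots> \<le> real n * (3 * fact n)" by (intro mult_right_mono) auto
  finally show ?thesis by simp
qed

lemma card_large_ascent_excess:
  assumes "0 < b"
  shows "real (card {\<sigma>\<in>arrangements n. b \<le> \<bar>ascent_excess n \<sigma>\<bar>}) / fact n \<le> 3 * real n / b\<^sup>2"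
proof -
  let ?B = "{\<sigma>\<in>arrangements n. b \<le> \<bar>ascent_excess n \<sigma>\<bar>}"
  have "real (card ?B) * b\<^sup>2 = (\<Sum>\<sigma>\<in>?B. b\<^sup>2)" by simp
  also have "\<dots> \<le> (\<Sum>\<sigma>\<in>?B. (ascent_excess n \<sigma>)\<^sup>2)"
    using assms by (intro sum_mono) (auto simp: abs_le_square_iff[symmetric])
  also have "\<dots> \<le> (\<Sum>\<sigma>\<in>arrangements n. (ascent_excess n \<sigma>)\<^sup>2)"
    by (intro sum_mono2) auto
  also have "\<dots> \<le> 3 * real n * fact n" by (rule sum_ascent_excess_sq)
  finally show ?thesis using assms by (simp add: field_simps)
qed

section \<open>The density of a riffle shuffle\<close>

text \<open>
  Expanding the binomial coefficient as a product of \<open>n\<close> consecutive integers, from \<open>m - r + 1\<close> to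
  \<open>m - r + n\<close>, gives one factor for each power of \<open>m\<close> in the denominator.
\<close>
lemma riffle_density_prod:
  assumes "1 \<le> n" "rising_sequences n \<sigma> \<le> m"
  shows "fact n * riffle n m \<sigma> = (\<Prod>i=1..n. 1 + (real i - real (rising_sequences n \<sigma>)) / real m)"
proof -
  define r where "r = rising_sequences n \<sigma>"
  have r: "1 \<le> r" "r \<le> m" using assms rising_sequences_bounds by (auto simp: r_def)
  have "real ((n + m - r) choose n) = pochhammer (real (n + m - r) - real n + 1) n / fact n"
    by (simp add: binomial_gbinomial gbinomial_pochhammer')
  also have "real (n + m - r) - real n + 1 = real m - real r + 1" using r by (simp add: of_nat_diff)
  also have "pochhammer (real m - real r + 1) n = (\<Prod>i=0..<n. real m - real r + 1 + real i)"
    by (simp add: pochhammer_prod)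
  also have "\<dots> = (\<Prod>i=1..n. real m - real r + real i)"
    by (rule prod.reindex_bij_witness[of _ "\<lambda>i. i - 1" Suc]) auto
  finally have "fact n * riffle n m \<sigma> = (\<Prod>i=1..n. real m - real r + real i) / real m ^ n"
    by (simp add: riffle_def r_def)
  also have "\<dots> = (\<Prod>i=1..n. (real m - real r + real i) / real m)"
    by (simp add: prod_dividef)
  also have "\<dots> = (\<Prod>i=1..n. 1 + (real i - real r) / real m)"
    using r by (intro prod.cong refl) (simp add: field_simps)
  finally show ?thesis by (simp add: r_def)
qed

lemma sum_shifted: "(\<Sum>i=1..n. real i - r) = real n * (real n + 1 - 2 * r) / 2"
  by (induction n) (auto simp: field_simps)

text \<open>
  Divided by \<open>n\<close>, this is the variance of a uniform index plus the squared distance of its mean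
  \<open>(n + 1) / 2\<close> from \<open>r\<close>.
\<close>
lemma sum_shifted_sq:
  "(\<Sum>i=1..n. (real i - r)\<^sup>2) = real n * (real n ^ 2 - 1) / 12 + real n * (r - (real n + 1) / 2)\<^sup>2"
  by (induction n) (auto simp: field_simps power2_eq_square)

text \<open>
  For \<open>2 * n \<le> m\<close> every factor \<open>1 + t\<close> of the density has \<open>\<bar>t\<bar> \<le> n / m \<le> 1 / 2\<close>, where
  \<open>ln (1 + t) \<ge> t - 2 * t\<^sup>2\<close>.
\<close>
lemma riffle_density_ge:
  assumes "1 \<le> n" "2 * n \<le> m"
  shows "exp (real n * ascent_excess n \<sigma> / (2 * real m) - 2 * real n ^ 3 / (real m)\<^sup>2)
    \<le> fact n * riffle n m \<sigma>"
proof -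
  define r where "r = rising_sequences n \<sigma>"
  define t where "t i = (real i - real r) / real m" for i
  have r: "1 \<le> r" "r \<le> n" using assms rising_sequences_bounds by (auto simp: r_def)
  have m: "0 < real m" using assms by simp
  have abs_le: "\<bar>t i\<bar> \<le> real n / real m" if "i \<in> {1..n}" for i
  proof -
    have "\<bar>real i - real r\<bar> \<le> real n" using that r by auto
    then show ?thesis unfolding t_def using m by (simp add: abs_divide divide_right_mono)
  qed
  have half: "real n / real m \<le> 1 / 2" using assms m by (simp add: field_simps)
  have "exp (\<Sum>i=1..n. t i - 2 * (real n / real m)\<^sup>2) = (\<Prod>i=1..n. exp (t i - 2 * (real n / real m)\<^sup>2))"
    by (simp add: exp_sum)
  also have "\<dots> \<le> (\<Prod>i=1..n. 1 + t i)"
  proof (intro prod_mono conjI)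
    fix i assume i: "i \<in> {1..n}"
    have t: "\<bar>t i\<bar> \<le> 1 / 2" using abs_le[OF i] half by linarith
    then have "\<bar>ln (1 + t i) - t i\<bar> \<le> 2 * (t i)\<^sup>2" by (rule abs_ln_one_plus_x_minus_x_bound)
    moreover have "(t i)\<^sup>2 \<le> (real n / real m)\<^sup>2" using abs_le[OF i] by (simp add: abs_le_square_iff[symmetric])
    ultimately have "t i - 2 * (real n / real m)\<^sup>2 \<le> ln (1 + t i)" by linarith
    then show "exp (t i - 2 * (real n / real m)\<^sup>2) \<le> 1 + t i"
      using t by (subst (asm) ln_ge_iff) auto
  qed simp
  also have "\<dots> = fact n * riffle n m \<sigma>"
    using riffle_density_prod[of n \<sigma> m] assms r by (simp add: r_def t_def)
  also have "(\<Sum>i=1..n. t i - 2 * (real n / real m)\<^sup>2) = (\<Sum>i=1..n. real i - real r) / real m - real n * (2 * (real n / real m)\<^sup>2)"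
    by (simp add: sum_subtractf t_def sum_divide_distrib[symmetric])
  also have "\<dots> = real n * ascent_excess n \<sigma> / (2 * real m) - 2 * real n ^ 3 / (real m)\<^sup>2"
    unfolding sum_shifted ascent_excess_rising_sequences[OF assms(1)] r_def
    by (simp add: power2_eq_square power3_eq_cube)
  finally show ?thesis .
qed

text \<open>
  The difference \<open>t - t\<^sup>2 / 6 - ln (1 + t)\<close> vanishes at \<open>0\<close> and has derivative
  \<open>t * (2 - t) / (3 * (1 + t))\<close>: it decreases before \<open>0\<close> and increases up to \<open>2\<close>.
\<close>
lemma one_plus_le_exp_quadratic:
  fixes t :: real
  assumes "- 1 < t" "t \<le> 2"
  shows "1 + t \<le> exp (t - t\<^sup>2 / 6)"
proof -
  define f where "f x = x - x\<^sup>2 / 6 - ln (1 + x)" for x :: real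
  have deriv: "(f has_real_derivative x * (2 - x) / (3 * (1 + x))) (at x)" if "- 1 < x" for x
    unfolding f_def using that
    by (auto intro!: derivative_eq_intros simp: field_simps power2_eq_square)
  have "f 0 \<le> f t"
  proof (cases "0 \<le> t")
    case True
    show ?thesis
    proof (rule DERIV_nonneg_imp_nondecreasing[OF True])
      fix x assume "0 \<le> x" "x \<le> t"
      then show "\<exists>y. (f has_real_derivative y) (at x) \<and> 0 \<le> y"
        using assms deriv[of x] by (intro exI[of _ "x * (2 - x) / (3 * (1 + x))"] conjI) auto
    qed
  next
    case False
    then have "t \<le> 0" by simp
    then show ?thesis
    proof (rule DERIV_nonpos_imp_nonincreasing)
      fix x assume "t \<le> x" "x \<le> 0"
      then show "\<exists>y. (f has_real_derivative y) (at x) \<and> y \<le> 0"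
        using assms deriv[of x]
        by (intro exI[of _ "x * (2 - x) / (3 * (1 + x))"] conjI) (auto simp: divide_nonpos_pos mult_nonpos_nonneg)
    qed
  qed
  then have "ln (1 + t) \<le> t - t\<^sup>2 / 6" by (simp add: f_def)
  then have "exp (ln (1 + t)) \<le> exp (t - t\<^sup>2 / 6)" by simp
  then show ?thesis using assms by simp
qed

text \<open>
  The condition \<open>n \<le> 3 * r\<close>, together with \<open>r \<le> m\<close>, keeps every factor \<open>1 + t\<close> of the density in the
  range \<open>- 1 < t \<le> 2\<close> of the quadratic bound, even for \<open>m\<close> much smaller than \<open>n\<close>. It holds for all
  typical arrangements. The constant \<open>72 = 6 * 12\<close> combines the \<open>6\<close> of that bound with the variance
  of a uniform index.
\<close>
lemma riffle_density_le:
  assumes "1 \<le> n" "rising_sequences n \<sigma> \<le> m" "real n \<le> 3 * real (rising_sequences n \<sigma>)"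
  shows "fact n * riffle n m \<sigma> \<le>
    exp (real n * ascent_excess n \<sigma> / (2 * real m) - real n * ((real n)\<^sup>2 - 1) / (72 * (real m)\<^sup>2))"
proof -
  define r where "r = rising_sequences n \<sigma>"
  define t where "t i = (real i - real r) / real m" for i
  have r: "1 \<le> r" "r \<le> m" "r \<le> n" "real n \<le> 3 * real r"
    using assms rising_sequences_bounds by (auto simp: r_def)
  then have m: "0 < real m" by simp
  have t: "- 1 < t i" "t i \<le> 2" if "i \<in> {1..n}" for i
  proof -
    have i: "1 \<le> real i" "real i \<le> real n" using that by auto
    have rm: "real r \<le> real m" using r by simp
    show "- 1 < t i" using i rm m by (simp add: t_def field_simps)
    show "t i \<le> 2" using i rm m r(4) by (simp add: t_def field_simps)
  qed
  have "fact n * riffle n m \<sigma> = (\<Prod>i=1..n. 1 + t i)"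
    using riffle_density_prod[of n \<sigma> m] assms by (simp add: r_def t_def)
  also have "\<dots> \<le> (\<Prod>i=1..n. exp (t i - (t i)\<^sup>2 / 6))"
  proof (intro prod_mono conjI)
    fix i assume i: "i \<in> {1..n}"
    show "0 \<le> 1 + t i" using t(1)[OF i] by simp
    show "1 + t i \<le> exp (t i - (t i)\<^sup>2 / 6)" using t[OF i] by (rule one_plus_le_exp_quadratic)
  qed
  also have "\<dots> = exp (\<Sum>i=1..n. t i - (t i)\<^sup>2 / 6)" by (simp add: exp_sum)
  also have "(\<Sum>i=1..n. t i - (t i)\<^sup>2 / 6) =
      (\<Sum>i=1..n. real i - real r) / real m - (\<Sum>i=1..n. (real i - real r)\<^sup>2) / (6 * (real m)\<^sup>2)"
  proof -
    have "(\<Sum>i=1..n. t i) = (\<Sum>i=1..n. real i - real r) / real m"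
      unfolding t_def by (rule sum_divide_distrib[symmetric])
    moreover have "(\<Sum>i=1..n. (t i)\<^sup>2 / 6) = (\<Sum>i=1..n. (real i - real r)\<^sup>2) / (6 * (real m)\<^sup>2)"
      unfolding t_def sum_divide_distrib by (rule sum.cong) (simp_all add: power_divide)
    ultimately show ?thesis by (simp only: sum_subtractf)
  qed
  also have "\<dots> \<le> real n * ascent_excess n \<sigma> / (2 * real m) - real n * ((real n)\<^sup>2 - 1) / (72 * (real m)\<^sup>2)"
  proof -
    have "real n * ((real n)\<^sup>2 - 1) / 12 \<le> (\<Sum>i=1..n. (real i - real r)\<^sup>2)"
      unfolding sum_shifted_sq by simp
    then have "real n * ((real n)\<^sup>2 - 1) / 12 / (6 * (real m)\<^sup>2) \<le> (\<Sum>i=1..n. (real i - real r)\<^sup>2) / (6 * (real m)\<^sup>2)"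
      by (rule divide_right_mono) simp
    then show ?thesis
      unfolding sum_shifted ascent_excess_rising_sequences[OF assms(1)] r_def[symmetric] by simp
  qed
  finally show ?thesis by simp
qed

lemma riffle_eq_0: "1 \<le> n \<Longrightarrow> m < rising_sequences n \<sigma> \<Longrightarrow> riffle n m \<sigma> = 0"
  using rising_sequences_bounds[of n \<sigma>] by (simp add: riffle_def binomial_eq_0)

section \<open>Total variation distance of mixtures\<close>

lemma tv_dist_upper: "A \<subseteq> arrangements n \<Longrightarrow> sum P A - sum Q A \<le> tv_dist n P Q"
  unfolding tv_dist_def by (rule cSUP_upper) (auto intro!: bdd_above_finite)

lemma tv_dist_least:
  assumes "\<And>A. A \<subseteq> arrangements n \<Longrightarrow> sum P A - sum Q A \<le> c"
  shows "tv_dist n P Q \<le> c"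
  unfolding tv_dist_def using assms by (intro cSUP_least) auto

lemma sum_uniform: "A \<subseteq> arrangements n \<Longrightarrow> sum (uniform n) A = real (card A) / fact n"
  by (simp add: uniform_def card_arrangements)

lemma sum_expectation_riffle:
  assumes "A \<subseteq> arrangements n" "1 \<le> n"
  shows "(\<Sum>\<sigma>\<in>A. measure_pmf.expectation M (\<lambda>m. riffle n m \<sigma>)) = measure_pmf.expectation M (\<lambda>m. \<Sum>\<sigma>\<in>A. riffle n m \<sigma>)"
  using assms riffle_bounded
  by (intro Bochner_Integration.integral_sum[symmetric] integrable_pmf_bounded[where B=1]) blast

lemma sum_expectation_riffle_UNIV:
  assumes "1 \<le> n" "\<And>m. m \<in> set_pmf M \<Longrightarrow> 1 \<le> m"
  shows "(\<Sum>\<sigma>\<in>arrangements n. measure_pmf.expectation M (\<lambda>m. riffle n m \<sigma>)) = 1"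
proof -
  have "measure_pmf.expectation M (\<lambda>m. \<Sum>\<sigma>\<in>arrangements n. riffle n m \<sigma>) = measure_pmf.expectation M (\<lambda>m. 1)"
    using assms by (intro integral_cong_AE AE_pmfI) (auto simp: sum_riffle)
  then show ?thesis using sum_expectation_riffle[of "arrangements n" n M] assms
    by (simp add: measure_pmf.prob_space[simplified])
qed

text \<open>
  Passing to the complement of \<open>A\<close>, it is enough to bound how far \<open>P\<close> falls below the uniform
  distribution. On arrangements with \<open>ascent_excess n \<sigma> \<ge> - b\<close> the components with \<open>m \<ge> x\<close> already
  supply the fraction \<open>1 - \<eta>\<close> of the uniform mass, so only a lower bound on the density is required.
\<close>
lemma tv_dist_mixture_le:
  fixes M :: "nat pmf" and n :: nat
  defines "P \<equiv> \<lambda>\<sigma>. measure_pmf.expectation M (\<lambda>m. riffle n m \<sigma>)"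
  assumes n: "1 \<le> n" and pos: "\<And>m. m \<in> set_pmf M \<Longrightarrow> 1 \<le> m" and b: "0 < b" and \<eta>: "0 \<le> \<eta>" "\<eta> \<le> 1"
    and good: "\<And>m \<sigma>. x \<le> real m \<Longrightarrow> - b \<le> ascent_excess n \<sigma> \<Longrightarrow> 1 - \<eta> \<le> fact n * riffle n m \<sigma>"
  shows "tv_dist n P (uniform n) \<le> 3 * real n / b\<^sup>2 + \<eta> + measure_pmf.prob M {m. real m < x}"
proof (rule tv_dist_least)
  fix A assume A: "A \<subseteq> arrangements n"
  define q where "q = measure_pmf.prob M {m. real m < x}"
  let ?C = "arrangements n - A"
  let ?B = "{\<sigma>\<in>arrangements n. b \<le> \<bar>ascent_excess n \<sigma>\<bar>}"
  have q: "0 \<le> q" "q \<le> 1" by (simp_all add: q_def)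
  have compl: "measure_pmf.prob M {m. x \<le> real m} = 1 - q"
  proof -
    have "{m. x \<le> real m} = UNIV - {m. real m < x}" by auto
    then show ?thesis unfolding q_def using measure_pmf.prob_compl[of "{m. real m < x}" M] by simp
  qed
  have P_nonneg: "0 \<le> P \<sigma>" for \<sigma> unfolding P_def by (intro Bochner_Integration.integral_nonneg) simp
  have P_ge: "(1 - q - \<eta>) / fact n \<le> P \<sigma>" if \<sigma>: "\<sigma> \<in> arrangements n" "- b \<le> ascent_excess n \<sigma>" for \<sigma>
  proof -
    have "(1 - q - \<eta>) / fact n \<le> (1 - q) * ((1 - \<eta>) / fact n)"
      using q \<eta> by (simp add: field_simps)
    also have "\<dots> = measure_pmf.expectation M (\<lambda>m. indicator {m. x \<le> real m} m * ((1 - \<eta>) / fact n))"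
      by (simp add: compl)
    also have "\<dots> \<le> P \<sigma>"
      unfolding P_def
    proof (rule integral_mono)
      show "integrable (measure_pmf M) (\<lambda>m. riffle n m \<sigma>)"
        using riffle_bounded[OF \<sigma>(1) n] by (rule integrable_pmf_bounded)
      show "indicator {m. x \<le> real m} m * ((1 - \<eta>) / fact n) \<le> riffle n m \<sigma>" for m
        using good[OF _ \<sigma>(2), of m] by (auto simp: field_simps split: split_indicator)
    qed (auto intro!: integrable_pmf_bounded[where B="(1 - \<eta>) / fact n"] simp: \<eta> split: split_indicator)
    finally show ?thesis .
  qed
  have sumC: "sum f A = sum f (arrangements n) - sum f ?C" for f :: "(nat \<Rightarrow> nat) \<Rightarrow> real"
    using A by (simp add: sum_diff)
  have "sum P A - sum (uniform n) A = (\<Sum>\<sigma>\<in>?C. 1 / fact n - P \<sigma>)"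
    unfolding sumC using sum_expectation_riffle_UNIV[OF n pos, of M, folded P_def] sum_uniform[of "arrangements n" n]
    by (simp add: sum_subtractf uniform_def card_arrangements)
  also have "\<dots> \<le> (\<Sum>\<sigma>\<in>?C. (if \<sigma> \<in> ?B then 1 / fact n else 0) + (q + \<eta>) / fact n)"
  proof (rule sum_mono)
    fix \<sigma> assume \<sigma>: "\<sigma> \<in> ?C"
    show "1 / fact n - P \<sigma> \<le> (if \<sigma> \<in> ?B then 1 / fact n else 0) + (q + \<eta>) / fact n"
    proof (cases "\<sigma> \<in> ?B")
      case True
      then show ?thesis using P_nonneg[of \<sigma>] q \<eta> by (simp add: add_increasing2)
    next
      case False
      then have "- b \<le> ascent_excess n \<sigma>" using \<sigma> by auto
      then have "(1 - q - \<eta>) / fact n \<le> P \<sigma>" using P_ge \<sigma> by blast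
      then show ?thesis unfolding if_not_P[OF False] by (simp add: diff_divide_distrib add_divide_distrib)
    qed
  qed
  also have "\<dots> \<le> (\<Sum>\<sigma>\<in>arrangements n. (if \<sigma> \<in> ?B then 1 / fact n else 0) + (q + \<eta>) / fact n)"
    using q \<eta> by (intro sum_mono2) auto
  also have "\<dots> = (\<Sum>\<sigma>\<in>arrangements n \<inter> ?B. 1 / fact n) + (q + \<eta>)"
    unfolding sum.distrib by (subst sum.inter_restrict) (simp_all add: card_arrangements)
  also have "(\<Sum>\<sigma>\<in>arrangements n \<inter> ?B. 1 / fact n) = real (card ?B) / fact n"
    by (simp add: Int_absorb1 Collect_restrict)
  also have "\<dots> \<le> 3 * real n / b\<^sup>2" by (rule card_large_ascent_excess[OF b])
  finally show "sum P A - sum (uniform n) A \<le> 3 * real n / b\<^sup>2 + \<eta> + measure_pmf.prob M {m. real m < x}"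
    by (simp add: q_def)
qed

text \<open>
  The test event is \<open>ascent_excess n \<sigma> > b\<close>. It does not depend on \<open>m\<close>, so it separates the whole
  mixture from the uniform distribution at once.
\<close>
lemma tv_dist_mixture_ge:
  fixes M :: "nat pmf" and n :: nat
  defines "P \<equiv> \<lambda>\<sigma>. measure_pmf.expectation M (\<lambda>m. riffle n m \<sigma>)"
  assumes n: "1 \<le> n" and pos: "\<And>m. m \<in> set_pmf M \<Longrightarrow> 1 \<le> m" and b: "0 < b" and \<eta>: "0 \<le> \<eta>"
    and small: "\<And>m \<sigma>. real m \<le> x \<Longrightarrow> ascent_excess n \<sigma> \<le> b \<Longrightarrow> fact n * riffle n m \<sigma> \<le> \<eta>"
  shows "1 - (3 * real n / b\<^sup>2 + \<eta> + measure_pmf.prob M {m. x < real m}) \<le> tv_dist n P (uniform n)"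
proof -
  define q where "q = measure_pmf.prob M {m. x < real m}"
  let ?C = "{\<sigma>\<in>arrangements n. ascent_excess n \<sigma> \<le> b}"
  let ?A = "arrangements n - ?C"
  let ?B = "{\<sigma>\<in>arrangements n. b \<le> \<bar>ascent_excess n \<sigma>\<bar>}"
  have "sum P ?C = measure_pmf.expectation M (\<lambda>m. \<Sum>\<sigma>\<in>?C. riffle n m \<sigma>)"
    unfolding P_def by (rule sum_expectation_riffle[OF _ n]) auto
  also have "\<dots> \<le> measure_pmf.expectation M (\<lambda>m. indicator {m. x < real m} m + \<eta>)"
  proof (rule integral_mono_AE)
    have le1: "(\<Sum>\<sigma>\<in>?C. riffle n m \<sigma>) \<le> 1" if "m \<in> set_pmf M" for m
    proof -
      have "(\<Sum>\<sigma>\<in>?C. riffle n m \<sigma>) \<le> (\<Sum>\<sigma>\<in>arrangements n. riffle n m \<sigma>)" by (rule sum_mono2) auto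
      then show ?thesis using sum_riffle[OF pos[OF that] n] by simp
    qed
    show "AE m in measure_pmf M. (\<Sum>\<sigma>\<in>?C. riffle n m \<sigma>) \<le> indicator {m. x < real m} m + \<eta>"
    proof (rule AE_pmfI)
      fix m assume m: "m \<in> set_pmf M"
      show "(\<Sum>\<sigma>\<in>?C. riffle n m \<sigma>) \<le> indicator {m. x < real m} m + \<eta>"
      proof (cases "x < real m")
        case True
        then show ?thesis using le1[OF m] \<eta> by simp
      next
        case False
        have "(\<Sum>\<sigma>\<in>?C. riffle n m \<sigma>) \<le> (\<Sum>\<sigma>\<in>?C. \<eta> / fact n)"
          using small False by (intro sum_mono) (simp add: field_simps)
        also have "\<dots> \<le> (\<Sum>\<sigma>\<in>arrangements n. \<eta> / fact n)" using \<eta> by (intro sum_mono2) auto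
        also have "\<dots> = \<eta>" by (simp add: card_arrangements)
        finally show ?thesis using False by simp
      qed
    qed
    show "integrable (measure_pmf M) (\<lambda>m. \<Sum>\<sigma>\<in>?C. riffle n m \<sigma>)"
      using le1 by (intro integrable_pmf_bounded[where B=1]) (simp add: sum_nonneg)
    show "integrable (measure_pmf M) (\<lambda>m. indicator {m. x < real m} m + \<eta>)"
      using \<eta> by (intro integrable_pmf_bounded[where B="1 + \<eta>"]) (simp split: split_indicator)
  qed
  also have "\<dots> = q + \<eta>"
    unfolding q_def by (subst Bochner_Integration.integral_add)
      (auto simp: measure_pmf.prob_space[simplified] intro!: integrable_pmf_bounded[where B=1] split: split_indicator)
  finally have PC: "sum P ?C \<le> q + \<eta>" .
  have PA: "sum P ?A = 1 - sum P ?C"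
    using sum_expectation_riffle_UNIV[OF n pos, of M] by (simp add: sum_diff P_def)
  have "sum (uniform n) ?A = real (card ?A) / fact n" by (rule sum_uniform) auto
  also have "\<dots> \<le> real (card ?B) / fact n"
    by (intro divide_right_mono of_nat_mono card_mono) auto
  also have "\<dots> \<le> 3 * real n / b\<^sup>2" by (rule card_large_ascent_excess[OF b])
  finally have "sum (uniform n) ?A \<le> 3 * real n / b\<^sup>2" .
  moreover have "sum P ?A - sum (uniform n) ?A \<le> tv_dist n P (uniform n)"
    by (rule tv_dist_upper) auto
  ultimately show ?thesis using PC PA unfolding q_def by linarith
qed

section \<open>The threshold for the number of packs\<close>

lemma mixture_tv_tendsto_0:
  fixes M :: "nat \<Rightarrow> nat pmf" and \<gamma> :: real
  assumes \<gamma>: "0 < \<gamma>" and pos: "\<And>n m. m \<in> set_pmf (M n) \<Longrightarrow> 1 \<le> m"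
    and tail: "(\<lambda>n. measure_pmf.prob (M n) {m. real m < real n powr (3 / 2 + 2 * \<gamma>)}) \<longlonglongrightarrow> 0"
  shows "(\<lambda>n. tv_dist n (\<lambda>\<sigma>. measure_pmf.expectation (M n) (\<lambda>m. riffle n m \<sigma>)) (uniform n)) \<longlonglongrightarrow> 0"
proof -
  let ?tv = "\<lambda>n. tv_dist n (\<lambda>\<sigma>. measure_pmf.expectation (M n) (\<lambda>m. riffle n m \<sigma>)) (uniform n)"
  define x where "x n = real n powr (3 / 2 + 2 * \<gamma>)" for n
  \<comment> \<open>Any exponent above \<open>1 / 2\<close> puts \<open>b\<close> beyond the fluctuations; it must
      stay below \<open>1 / 2 + 2 * \<gamma>\<close> for \<open>w\<close> to vanish.\<close>
  define b where "b n = real n powr (1 / 2 + \<gamma>)" for n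
  define w where "w n = - (real n * b n / (2 * x n)) - 2 * real n ^ 3 / (x n)\<^sup>2" for n
  let ?q = "\<lambda>n. measure_pmf.prob (M n) {m. real m < x n}"
  have w: "w \<longlonglongrightarrow> 0" unfolding w_def b_def x_def using \<gamma> by real_asymp
  have "(\<lambda>n. 3 * real n / (b n)\<^sup>2 + (1 - exp (w n)) + ?q n) \<longlonglongrightarrow> 0 + (1 - exp 0) + 0"
  proof (intro tendsto_intros w)
    show "(\<lambda>n. 3 * real n / (b n)\<^sup>2) \<longlonglongrightarrow> 0" unfolding b_def using \<gamma> by real_asymp
    show "?q \<longlonglongrightarrow> 0" using tail by (simp add: x_def)
  qed
  then have lim: "(\<lambda>n. 3 * real n / (b n)\<^sup>2 + (1 - exp (w n)) + ?q n) \<longlonglongrightarrow> 0" by simp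
  have wide: "\<forall>\<^sub>F n in sequentially. 2 * real n \<le> x n" unfolding x_def using \<gamma> by real_asymp
  show ?thesis
  proof (rule tendsto_sandwich[OF _ _ tendsto_const lim])
    show "\<forall>\<^sub>F n in sequentially. 0 \<le> ?tv n"
      using tv_dist_upper[of "{}"] by (intro always_eventually allI) auto
    show "\<forall>\<^sub>F n in sequentially. ?tv n \<le> 3 * real n / (b n)\<^sup>2 + (1 - exp (w n)) + ?q n"
      using wide eventually_ge_at_top[of 1]
    proof eventually_elim
      case (elim n)
      have bp: "0 < b n" and xp: "0 < x n" using elim by (simp_all add: b_def x_def)
      show ?case
      proof (rule tv_dist_mixture_le)
        show "1 \<le> n" "0 < b n" by fact+
        show "1 \<le> m" if "m \<in> set_pmf (M n)" for m using pos that .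
        have "0 \<le> real n * b n / (2 * x n)" "0 \<le> 2 * real n ^ 3 / (x n)\<^sup>2"
          using bp xp by simp_all
        then have "w n \<le> 0" unfolding w_def by linarith
        then show "0 \<le> 1 - exp (w n)" "1 - exp (w n) \<le> 1" by simp_all
        fix m \<sigma> assume m: "x n \<le> real m" and e: "- b n \<le> ascent_excess n \<sigma>"
        have mp: "0 < real m" using m xp by simp
        have "2 * n \<le> m" using m elim by linarith
        have "2 * real n ^ 3 / (real m)\<^sup>2 \<le> 2 * real n ^ 3 / (x n)\<^sup>2"
          using m xp by (intro divide_left_mono power_mono mult_pos_pos zero_less_power) auto
        moreover have "real n * (- b n) / (2 * real m) \<le> real n * ascent_excess n \<sigma> / (2 * real m)"
          using e mp by (intro divide_right_mono mult_left_mono) auto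
        moreover have "real n * b n / (2 * real m) \<le> real n * b n / (2 * x n)"
          using m xp bp by (intro divide_left_mono mult_pos_pos) auto
        ultimately have "w n \<le> real n * ascent_excess n \<sigma> / (2 * real m) - 2 * real n ^ 3 / (real m)\<^sup>2"
          unfolding w_def by simp
        then have "exp (w n) \<le> exp (real n * ascent_excess n \<sigma> / (2 * real m) - 2 * real n ^ 3 / (real m)\<^sup>2)" by simp
        also have "\<dots> \<le> fact n * riffle n m \<sigma>"
          by (rule riffle_density_ge) fact+
        finally show "1 - (1 - exp (w n)) \<le> fact n * riffle n m \<sigma>" by simp
      qed
    qed
  qed
qed

lemma mixture_tv_tendsto_1:
  fixes M :: "nat \<Rightarrow> nat pmf" and \<gamma> :: real
  assumes \<gamma>: "0 < \<gamma>" "\<gamma> < 1 / 2" and pos: "\<And>n m. m \<in> set_pmf (M n) \<Longrightarrow> 1 \<le> m"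
    and tail: "(\<lambda>n. measure_pmf.prob (M n) {m. real n powr (3 / 2 - 2 * \<gamma>) < real m}) \<longlonglongrightarrow> 0"
  shows "(\<lambda>n. tv_dist n (\<lambda>\<sigma>. measure_pmf.expectation (M n) (\<lambda>m. riffle n m \<sigma>)) (uniform n)) \<longlonglongrightarrow> 1"
proof -
  let ?tv = "\<lambda>n. tv_dist n (\<lambda>\<sigma>. measure_pmf.expectation (M n) (\<lambda>m. riffle n m \<sigma>)) (uniform n)"
  define x where "x n = real n powr (3 / 2 - 2 * \<gamma>)" for n
  \<comment> \<open>The exponent lies above \<open>1 / 2\<close>, so \<open>b\<close> exceeds the fluctuations, and
      below \<open>1 / 2 + 2 * \<gamma>\<close>, so the quadratic term wins.\<close>
  define b where "b n = real n powr (1 / 2 + \<gamma>)" for n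
  define w where "w n = - (real n ^ 3 / 288) / (x n)\<^sup>2" for n
  let ?q = "\<lambda>n. measure_pmf.prob (M n) {m. x n < real m}"
  have "(\<lambda>n. 1 - (3 * real n / (b n)\<^sup>2 + exp (w n) + ?q n)) \<longlonglongrightarrow> 1 - (0 + 0 + 0)"
  proof (intro tendsto_intros)
    show "(\<lambda>n. 3 * real n / (b n)\<^sup>2) \<longlonglongrightarrow> 0" unfolding b_def using \<gamma> by real_asymp
    show "(\<lambda>n. exp (w n)) \<longlonglongrightarrow> 0" unfolding w_def x_def using \<gamma> by real_asymp
    show "?q \<longlonglongrightarrow> 0" using tail by (simp add: x_def)
  qed
  then have lim: "(\<lambda>n. 1 - (3 * real n / (b n)\<^sup>2 + exp (w n) + ?q n)) \<longlonglongrightarrow> 1" by simp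
  \<comment> \<open>On \<open>ascent_excess n \<sigma> \<le> b n\<close> this makes \<open>r\<close> at least \<open>n / 3\<close>, as the density bound requires.\<close>
  have narrow: "\<forall>\<^sub>F n in sequentially. b n \<le> real n / 3" unfolding b_def using \<gamma> by real_asymp
  have dominant: "\<forall>\<^sub>F n in sequentially.
      real n * b n * x n / 2 - real n * ((real n)\<^sup>2 - 1) / 72 \<le> - (real n ^ 3 / 288)"
    unfolding b_def x_def using \<gamma> by real_asymp
  show ?thesis
  proof (rule tendsto_sandwich[OF _ _ lim tendsto_const])
    show "\<forall>\<^sub>F n in sequentially. ?tv n \<le> 1"
      using eventually_ge_at_top[of 1]
    proof eventually_elim
      case (elim n)
      let ?P = "\<lambda>\<sigma>. measure_pmf.expectation (M n) (\<lambda>m. riffle n m \<sigma>)"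
      show ?case
      proof (rule tv_dist_least)
        fix A assume A: "A \<subseteq> arrangements n"
        have "sum ?P A \<le> sum ?P (arrangements n)"
          using A by (intro sum_mono2 Bochner_Integration.integral_nonneg) auto
        moreover have "sum ?P (arrangements n) = 1"
          by (rule sum_expectation_riffle_UNIV[OF elim pos])
        moreover have "0 \<le> sum (uniform n) A" using A by (simp add: sum_uniform)
        ultimately show "sum ?P A - sum (uniform n) A \<le> 1" by linarith
      qed
    qed
    show "\<forall>\<^sub>F n in sequentially. 1 - (3 * real n / (b n)\<^sup>2 + exp (w n) + ?q n) \<le> ?tv n"
      using narrow dominant eventually_ge_at_top[of 1]
    proof eventually_elim
      case (elim n)
      have bp: "0 < b n" and xp: "0 < x n" using elim by (simp_all add: b_def x_def)
      show ?case
      proof (rule tv_dist_mixture_ge)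
        show "1 \<le> n" "0 < b n" by fact+
        show "1 \<le> m" if "m \<in> set_pmf (M n)" for m using pos that .
        show "0 \<le> exp (w n)" by simp
        fix m \<sigma> assume m: "real m \<le> x n" and e: "ascent_excess n \<sigma> \<le> b n"
        let ?r = "rising_sequences n \<sigma>"
        show "fact n * riffle n m \<sigma> \<le> exp (w n)"
        \<comment> \<open>With fewer packs than rising sequences the arrangement cannot occur.\<close>
        proof (cases "m < ?r")
          case True
          then show ?thesis using riffle_eq_0[OF \<open>1 \<le> n\<close>] by simp
        next
          case False
          then have rm: "?r \<le> m" by simp
          then have mp: "0 < real m" using rising_sequences_bounds[OF \<open>1 \<le> n\<close>, of \<sigma>] by simp
          have r3: "real n \<le> 3 * real ?r"
            using ascent_excess_rising_sequences[OF \<open>1 \<le> n\<close>, of \<sigma>] e elim by linarith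
          have "real n * ascent_excess n \<sigma> / (2 * real m) - real n * ((real n)\<^sup>2 - 1) / (72 * (real m)\<^sup>2)
              = (real n * ascent_excess n \<sigma> * real m / 2 - real n * ((real n)\<^sup>2 - 1) / 72) / (real m)\<^sup>2"
            using mp by (simp add: field_simps power2_eq_square)
          also have "\<dots> \<le> (- (real n ^ 3 / 288)) / (real m)\<^sup>2"
          proof (rule divide_right_mono)
            have "real n * ascent_excess n \<sigma> * real m \<le> real n * b n * real m"
              using e by (intro mult_right_mono mult_left_mono) auto
            also have "\<dots> \<le> real n * b n * x n"
              using m bp by (intro mult_left_mono) auto
            finally show "real n * ascent_excess n \<sigma> * real m / 2 - real n * ((real n)\<^sup>2 - 1) / 72 \<le> - (real n ^ 3 / 288)"
              using elim by linarith
          qed simp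
          also have "\<dots> \<le> w n"
          proof -
            have "(real m)\<^sup>2 \<le> (x n)\<^sup>2" using m by (intro power_mono) auto
            then have "(real n ^ 3 / 288) / (x n)\<^sup>2 \<le> (real n ^ 3 / 288) / (real m)\<^sup>2"
              using mp xp by (intro divide_left_mono mult_pos_pos) auto
            then show ?thesis by (simp add: w_def)
          qed
          finally have "exp (real n * ascent_excess n \<sigma> / (2 * real m) - real n * ((real n)\<^sup>2 - 1) / (72 * (real m)\<^sup>2)) \<le> exp (w n)"
            by simp
          then show ?thesis using riffle_density_le[OF \<open>1 \<le> n\<close> rm r3] by linarith
        qed
      qed
    qed
  qed
qed

lemma filterlim_at_top_of_real:
  "filterlim (\<lambda>n. real (k n)) at_top F \<Longrightarrow> filterlim k at_top F"
  unfolding filterlim_at_top by (metis (mono_tags, lifting) eventually_mono of_nat_le_iff)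

lemma tv_dist_cong: "(\<And>\<sigma>. \<sigma> \<in> arrangements n \<Longrightarrow> P \<sigma> = P' \<sigma>) \<Longrightarrow> tv_dist n P Q = tv_dist n P' Q"
  unfolding tv_dist_def by (intro arg_cong[where f=Sup] image_cong arg_cong2[where f=minus] sum.cong refl) auto

theorem theorem1p4:
  fixes p :: "nat pmf" and \<mu> \<epsilon> :: real
  assumes "pmf p 0 = 0"
    and "pmf p 1 \<noteq> 1"
    and "((\<lambda>k. pmf p k * ln (real k)) has_sum \<mu>) {1..}"
    and "0 < \<epsilon>" and "\<epsilon> < 1"
  shows "(\<forall>k :: nat \<Rightarrow> nat.
            (\<forall>n\<ge>1. real (k n) > (1 + \<epsilon>) * (3 / (2 * \<mu>)) * ln (real n)) \<longrightarrow>
            (\<lambda>n. tv_dist n (convolution_power n (riffle_mix n p) (k n)) (uniform n))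
              \<longlonglongrightarrow> 0) \<and>
         (\<forall>k :: nat \<Rightarrow> nat.
            (\<forall>\<^sub>F n in sequentially. real (k n) < (1 - \<epsilon>) * (3 / (2 * \<mu>)) * ln (real n)) \<longrightarrow>
            (\<lambda>n. tv_dist n (convolution_power n (riffle_mix n p) (k n)) (uniform n))
              \<longlonglongrightarrow> 1)"
proof -
  note p0 = assms(1)
  have nonneg: "0 \<le> pmf p k * ln (real k)" if "k \<in> {1..}" for k using that by simp
  have "(\<lambda>k. norm (pmf p k * ln (real k))) summable_on {1..}"
    using has_sum_imp_summable[OF assms(3)] nonneg by (subst summable_on_cong) auto
  then have summable: "Infinite_Set_Sum.abs_summable_on (\<lambda>k. pmf p k * ln (real k)) {1..}"
    by (rule abs_summable_equivalent[THEN iffD1])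
  have int: "integrable (measure_pmf p) (\<lambda>k. ln (real k))"
    and \<mu>: "\<mu> = measure_pmf.expectation p (\<lambda>k. ln (real k))"
    using expectation_pmf_infsum[OF p0 summable] infsumI[OF assms(3)] by auto
  have "\<mu> > 0"
  proof -
    have "\<not> set_pmf p \<subseteq> {1}" using assms(2) by (auto simp: set_pmf_subset_singleton)
    then obtain j where j: "j \<in> set_pmf p" "j \<noteq> 1" by blast
    then have "j \<noteq> 0" using p0 by (metis set_pmf_iff)
    then have "2 \<le> j" using j by linarith
    then have "0 < pmf p j * ln (real j)" using j by (simp add: pmf_positive)
    also have "\<dots> = (\<Sum>k\<in>{j}. pmf p k * ln (real k))" by simp
    also have "\<dots> \<le> \<mu>"
      using finite_sum_le_has_sum[OF assms(3), of "{j}"] nonneg \<open>2 \<le> j\<close> by simp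
    finally show ?thesis .
  qed
  let ?M = "iterated_product p"
  let ?mix = "\<lambda>k n. tv_dist n (\<lambda>\<sigma>. measure_pmf.expectation (?M (k n)) (\<lambda>m. riffle n m \<sigma>)) (uniform n)"
  let ?tv = "\<lambda>k n. tv_dist n (convolution_power n (riffle_mix n p) (k n)) (uniform n)"
  have tv_eq: "\<forall>\<^sub>F n in sequentially. ?mix k n = ?tv k n" for k
    using eventually_ge_at_top[of 1]
    by eventually_elim (rule tv_dist_cong, simp add: convolution_power_riffle_mix[OF p0])
  have "(?tv k) \<longlonglongrightarrow> 0"
    if k: "\<forall>n\<ge>1. real (k n) > (1 + \<epsilon>) * (3 / (2 * \<mu>)) * ln (real n)" for k
  proof -
    \<comment> \<open>Chosen so that \<open>(1 - \<epsilon> / 2) * (1 + \<epsilon>) * (3 / 2) = 3 / 2 + 2 * \<gamma>\<close>.\<close>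
    define \<gamma> where "\<gamma> = 3 / 8 * \<epsilon> * (1 - \<epsilon>)"
    define \<delta> where "\<delta> = \<mu> * \<epsilon> / 2"
    have \<gamma>: "0 < \<gamma>" and \<delta>: "0 < \<delta>" using assms \<open>\<mu> > 0\<close> by (simp_all add: \<gamma>_def \<delta>_def)
    have lim: "filterlim (\<lambda>n. (1 + \<epsilon>) * (3 / (2 * \<mu>)) * ln (real n)) at_top sequentially"
      using assms \<open>\<mu> > 0\<close> by real_asymp
    have "filterlim (\<lambda>n. real (k n)) at_top sequentially"
      by (rule filterlim_at_top_mono[OF lim])
         (use k in \<open>auto intro!: eventually_mono[OF eventually_ge_at_top[of 1]] less_imp_le\<close>)
    then have k_top: "filterlim k at_top sequentially" by (rule filterlim_at_top_of_real)
    have "(\<lambda>n. measure_pmf.prob (?M (k n)) {m. real m < real n powr (3 / 2 + 2 * \<gamma>)}) \<longlonglongrightarrow> 0"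
    proof (rule tendsto_sandwich[OF _ _ tendsto_const
          filterlim_compose[OF iterated_product_law_of_large_numbers(1)[OF p0 int \<mu> \<delta>] k_top]])
      show "\<forall>\<^sub>F n in sequentially. measure_pmf.prob (?M (k n)) {m. real m < real n powr (3 / 2 + 2 * \<gamma>)}
          \<le> measure_pmf.prob (?M (k n)) {m. real m < exp ((\<mu> - \<delta>) * real (k n))}"
        using eventually_ge_at_top[of 1]
      proof eventually_elim
        case (elim n)
        have "(3 / 2 + 2 * \<gamma>) * ln (real n) = (\<mu> - \<delta>) * ((1 + \<epsilon>) * (3 / (2 * \<mu>)) * ln (real n))"
          using \<open>\<mu> > 0\<close> by (simp add: \<gamma>_def \<delta>_def field_simps)
        also have "\<dots> \<le> (\<mu> - \<delta>) * real (k n)"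
        proof (rule mult_left_mono)
          show "0 \<le> \<mu> - \<delta>" using \<open>\<mu> > 0\<close> assms by (simp add: \<delta>_def field_simps)
        qed (use k elim in \<open>auto intro: less_imp_le\<close>)
        finally have "real n powr (3 / 2 + 2 * \<gamma>) \<le> exp ((\<mu> - \<delta>) * real (k n))"
          using elim by (simp add: powr_def)
        then show ?case by (intro measure_pmf.finite_measure_mono) auto
      qed
    qed simp
    then have "(?mix k) \<longlonglongrightarrow> 0"
      by (intro mixture_tv_tendsto_0[OF \<gamma>] iterated_product_pos[OF p0])
    then show ?thesis using tv_eq by (rule Lim_transform_eventually)
  qed
  moreover have "(?tv k) \<longlonglongrightarrow> 1"
    if k: "\<forall>\<^sub>F n in sequentially. real (k n) < (1 - \<epsilon>) * (3 / (2 * \<mu>)) * ln (real n)" for k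
  proof -
    \<comment> \<open>Here \<open>(1 + \<epsilon>) * (1 - \<epsilon>) * (3 / 2) = 3 / 2 - 4 * \<gamma>\<close>; the spare \<open>2 * \<gamma>\<close> absorbs the
      rounding in \<open>K\<close>.\<close>
    define \<gamma> where "\<gamma> = 3 / 8 * \<epsilon>\<^sup>2"
    define \<delta> where "\<delta> = \<mu> * \<epsilon>"
    \<comment> \<open>The sequence \<open>k\<close> need not tend to infinity, but its bound \<open>K\<close> does.\<close>
    define K where "K n = nat \<lceil>(1 - \<epsilon>) * (3 / (2 * \<mu>)) * ln (real n)\<rceil>" for n
    have \<gamma>: "0 < \<gamma>" and \<delta>: "0 < \<delta>" using assms \<open>\<mu> > 0\<close> by (simp_all add: \<gamma>_def \<delta>_def)
    have "\<epsilon>\<^sup>2 \<le> 1" using assms by (simp add: power_le_one)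
    then have \<gamma>2: "\<gamma> < 1 / 2" by (simp add: \<gamma>_def)
    have lim: "filterlim (\<lambda>n. (1 - \<epsilon>) * (3 / (2 * \<mu>)) * ln (real n)) at_top sequentially"
      using assms \<open>\<mu> > 0\<close> by real_asymp
    have "filterlim (\<lambda>n. real (K n)) at_top sequentially"
      by (rule filterlim_at_top_mono[OF lim]) (simp add: K_def real_nat_ceiling_ge)
    then have K_top: "filterlim K at_top sequentially" by (rule filterlim_at_top_of_real)
    have slack: "\<forall>\<^sub>F n in sequentially. (\<mu> + \<delta>) * ((1 - \<epsilon>) * (3 / (2 * \<mu>)) * ln (real n) + 1) \<le> (3 / 2 - 2 * \<gamma>) * ln (real n)"
    proof -
      have "\<forall>\<^sub>F n in sequentially. \<mu> + \<delta> \<le> 3 / 4 * \<epsilon>\<^sup>2 * ln (real n)"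
        using assms by real_asymp
      then show ?thesis
      proof eventually_elim
        case (elim n)
        have "(\<mu> + \<delta>) * ((1 - \<epsilon>) * (3 / (2 * \<mu>)) * ln (real n)) = (3 / 2 - 3 / 2 * \<epsilon>\<^sup>2) * ln (real n)"
          using \<open>\<mu> > 0\<close> by (simp add: \<delta>_def field_simps power2_eq_square)
        then show ?case using elim by (simp add: \<gamma>_def algebra_simps)
      qed
    qed
    have "(\<lambda>n. measure_pmf.prob (?M (k n)) {m. real n powr (3 / 2 - 2 * \<gamma>) < real m}) \<longlonglongrightarrow> 0"
    proof (rule tendsto_sandwich[OF _ _ tendsto_const
          filterlim_compose[OF iterated_product_law_of_large_numbers(2)[OF p0 int \<mu> \<delta>] K_top]])
      have cpos: "\<forall>\<^sub>F n in sequentially. 0 \<le> (1 - \<epsilon>) * (3 / (2 * \<mu>)) * ln (real n)"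
        using assms \<open>\<mu> > 0\<close> by real_asymp
      show "\<forall>\<^sub>F n in sequentially. measure_pmf.prob (?M (k n)) {m. real n powr (3 / 2 - 2 * \<gamma>) < real m}
          \<le> measure_pmf.prob (?M (K n)) {m. exp ((\<mu> + \<delta>) * real (K n)) < real m}"
        using eventually_ge_at_top[of 1] slack k cpos
      proof eventually_elim
        case (elim n)
        have "real (k n) \<le> real (K n)"
          using elim real_nat_ceiling_ge[of "(1 - \<epsilon>) * (3 / (2 * \<mu>)) * ln (real n)"] unfolding K_def by linarith
        then have kK: "k n \<le> K n" by simp
        have "real (K n) \<le> (1 - \<epsilon>) * (3 / (2 * \<mu>)) * ln (real n) + 1"
          using elim unfolding K_def by linarith
        then have "(\<mu> + \<delta>) * real (K n) \<le> (\<mu> + \<delta>) * ((1 - \<epsilon>) * (3 / (2 * \<mu>)) * ln (real n) + 1)"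
          using \<open>\<mu> > 0\<close> \<delta> by (intro mult_left_mono) auto
        then have "(\<mu> + \<delta>) * real (K n) \<le> (3 / 2 - 2 * \<gamma>) * ln (real n)" using elim by linarith
        then have le: "exp ((\<mu> + \<delta>) * real (K n)) \<le> real n powr (3 / 2 - 2 * \<gamma>)"
          using elim by (simp add: powr_def)
        have "measure_pmf.prob (?M (k n)) {m. real n powr (3 / 2 - 2 * \<gamma>) < real m}
            \<le> measure_pmf.prob (?M (K n)) {m. real n powr (3 / 2 - 2 * \<gamma>) < real m}"
          by (rule iterated_product_tail_mono[OF p0 kK])
        also have "\<dots> \<le> measure_pmf.prob (?M (K n)) {m. exp ((\<mu> + \<delta>) * real (K n)) < real m}"
          using le by (intro measure_pmf.finite_measure_mono) auto
        finally show ?case .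
      qed
    qed simp
    then have "(?mix k) \<longlonglongrightarrow> 1"
      by (intro mixture_tv_tendsto_1[OF \<gamma> \<gamma>2] iterated_product_pos[OF p0])
    then show ?thesis using tv_eq by (rule Lim_transform_eventually)
  qed
  ultimately show ?thesis by blast
qed

end
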